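(* Let $q$ be a complex number with $0<|q|<1$, and for $r\in\{1,3\}$ put $$w_r:=q^{r/2}\frac{f_rf_{21r}}{f_{3r}f_{7r}}.$$ If $P:=w_1w_3$ and $Q:=\dfrac{w_1}{w_3}$, then $$P^2+\frac{1}{P^2}=Q^2+\frac{1}{Q^2}+\left(P+\frac{1}{P}\right)\left[3+\left(Q+\frac{1}{Q}\right)^2+3\left(Q+\frac{1}{Q}\right)\right]+1.$$
   Context: For $|q|<1$, $f(-q):=\sum_{n=-\infty}^{\infty}(-1)^n q^{n(3n-1)/2}$, and $f_n:=f(-q^n)$ for positive integers $n$ (so $f_n$ is $f(-x)$ evaluated at $x=q^n$). A square root $q^{1/2}$ of $q$ is fixed (the positive one if $0<q<1$) and $q^{r/2}:=(q^{1/2})^r$. *)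

theory Defs
  imports "HOL-Analysis.Analysis"
begin

(* The defining series f(-x) = sum over all integers n of (-1)^n x^(n(3n-1)/2), written for
   the argument x of f.  The exponent is a nonnegative integer and the division is exact.
   The sum converges absolutely for norm x < 1, the only range in which f is used. *)
definition ramanujan_f :: "complex \<Rightarrow> complex" where
  "ramanujan_f x = (\<Sum>\<^sub>\<infinity>n\<in>(UNIV :: int set). (-1) powi n * (-x) powi (n * (3 * n - 1) div 2))"

definition f_sub :: "complex \<Rightarrow> nat \<Rightarrow> complex" where
  "f_sub q n = ramanujan_f (- (q ^ n))"

(* s is the chosen square root of q, so that q^(r/2) means s^r. *)
definition w :: "complex \<Rightarrow> complex \<Rightarrow> nat \<Rightarrow> complex" where
  "w q s r = s ^ r * (f_sub q r * f_sub q (21 * r)) / (f_sub q (3 * r) * f_sub q (7 * r))"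

end

theory Submission
  imports Defs "HOL-Probability.Probability" "HOL-Complex_Analysis.Complex_Analysis"
begin

text \<open>
  Put \<open>X = f\<^sub>1 f\<^sub>3 / (q f\<^sub>7 f\<^sub>2\<^sub>1)\<close> and let \<open>Y\<close> be the same expression in \<open>q^3\<close>. The
  classical modular equation of level 21,
  \<open>X + 7/X = w\<^sub>1^2 + w\<^sub>1^(-2) - 3\<close>, together with its image
  \<open>Y + 7/Y = w\<^sub>3^2 + w\<^sub>3^(-2) - 3\<close> under \<open>q \<rightarrow> q^3\<close> and the relations \<open>X = P Y\<close>,
  \<open>w\<^sub>1^2 = P Q\<close>, \<open>w\<^sub>3^2 = P/Q\<close>, gives after elimination of \<open>Y\<close> the claimed identity multiplied
  by \<open>(P - 1)^2\<close>. As a function of \<open>q\<close>, \<open>P\<close> is holomorphic in the unit disc with \<open>P(0) = 0\<close>, so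
  the points with \<open>P = 1\<close> are isolated and the factor can be removed by continuity.

  The level 21 equation says that a certain eta quotient \<open>G\<close> on the upper half plane vanishes.
  \<open>G\<close> is invariant under \<open>z \<rightarrow> z + 1\<close> and under three Atkin-Lehner involutions, which suffice
  to move every point into \<open>|Re z| \<le> 1/2, Im z \<ge> 1/50\<close>, and \<open>G \<rightarrow> 0\<close> at the cusp; so \<open>|G|\<close>
  attains its maximum and \<open>G\<close> is constant, hence zero. The invariance rests on
  \<open>\<eta>(-1/z) = sqrt(-i z) \<eta>(z)\<close>, obtained from Poisson summation for the Gaussian and the pentagonal
  number theorem.
\<close>

section \<open>The pentagonal number theorem\<close>

text \<open>The Euler product makes it visible that f(-z) has no zeros in the unit disc, which the
  bilateral series does not; \<open>f_sub_eq_phi_prod\<close> identifies the two, and afterwards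
  only the product is used.\<close>

definition phi_prod :: "complex \<Rightarrow> complex" where
  "phi_prod z = (\<Prod>k. 1 - z ^ Suc k)"

definition tri :: "nat \<Rightarrow> nat" where
  "tri s = s * (s + 1) div 2"

lemma tri_0 [simp]: "tri 0 = 0"
  and tri_Suc [simp]: "tri (Suc s) = tri s + Suc s"
  by (auto simp: tri_def)

lemma le_tri: "s \<le> tri s"
  by (induction s) auto

lemma prod_Suc_lower:
  fixes f :: "nat \<Rightarrow> 'a :: comm_monoid_mult"
  assumes "Suc s \<le> n"
  shows "prod f {s<..n} = f (Suc s) * prod f {Suc s<..n}"
proof -
  have "{s<..n} = insert (Suc s) {Suc s<..n}" using assms by auto
  then show ?thesis by simp
qed

text \<open>Shanks' finite form of the pentagonal number theorem: the sum of these terms over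
  \<open>s \<le> n\<close> is a partial pentagonal sum, while the term \<open>s = 0\<close> is \<open>(1 - q) \<cdots> (1 - q^n)\<close> and the
  others tend to 0.\<close>

definition shanks_term :: "'a::comm_ring_1 \<Rightarrow> nat \<Rightarrow> nat \<Rightarrow> 'a" where
  "shanks_term q n s = (-1) ^ s * q ^ (s * n + tri s) * (\<Prod>k\<in>{s<..n}. 1 - q ^ k)"

text \<open>Consecutive differences cancel except for one boundary term. Keeping the upper limit
  \<open>m\<close> apart from \<open>n\<close> lets the induction run on \<open>m\<close> with
  \<open>n\<close> fixed; the case \<open>m = n\<close> is the one applied below.\<close>

lemma shanks_telescope:
  fixes q :: "'a::comm_ring_1"
  assumes "m \<le> n"
  shows "(\<Sum>s\<le>m. shanks_term q (Suc n) s - shanks_term q n s) =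
    - ((-1) ^ m * q ^ (Suc m * Suc n + tri m) * (\<Prod>k\<in>{m<..n}. 1 - q ^ k))"
  using assms
proof (induction m)
  case 0
  have "{0<..Suc n} = insert (Suc n) {0<..n}" by auto
  then show ?case by (simp add: shanks_term_def algebra_simps)
next
  case (Suc m)
  define R where "R = (\<Prod>k\<in>{Suc m<..n}. 1 - q ^ k)"
  have R1: "(\<Prod>k\<in>{Suc m<..Suc n}. 1 - q ^ k) = (1 - q ^ Suc n) * R"
  proof -
    have "{Suc m<..Suc n} = insert (Suc n) {Suc m<..n}" using Suc.prems by auto
    then show ?thesis by (simp add: R_def)
  qed
  have R2: "(\<Prod>k\<in>{m<..n}. 1 - q ^ k) = (1 - q ^ Suc m) * R"
    using prod_Suc_lower[of m n "\<lambda>k. 1 - q ^ k"] Suc.prems by (simp add: R_def)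
  show ?case
    using Suc by (simp add: shanks_term_def R1 R2 R_def[symmetric] algebra_simps power_add)
qed

text \<open>The two terms of index s + 1 and -(s + 1) in the pentagonal series: the exponents are
  n(3n - 1)/2 for these n. The term n = 0 is left out, so the series sums to
  \<open>phi_prod q - 1\<close>.\<close>

definition pent_term :: "'a::comm_ring_1 \<Rightarrow> nat \<Rightarrow> 'a" where
  "pent_term q s = (-1) ^ Suc s * (q ^ (Suc s * s + tri (Suc s)) + q ^ (Suc s * Suc s + tri (Suc s)))"

text \<open>Passing from n to n + 1 contributes the boundary term of
  \<open>shanks_telescope\<close>, which is the first monomial of \<open>pent_term q n\<close>, and
  the new summand s = n + 1, which is the second.\<close>

lemma shanks_identity:
  fixes q :: "'a::comm_ring_1"
  shows "(\<Sum>s\<le>n. shanks_term q n s) = 1 + (\<Sum>s<n. pent_term q s)"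
proof (induction n)
  case 0
  then show ?case by (simp add: shanks_term_def)
next
  case (Suc n)
  have "(\<Sum>s\<le>Suc n. shanks_term q (Suc n) s) = (\<Sum>s\<le>n. shanks_term q n s) +
      (\<Sum>s\<le>n. shanks_term q (Suc n) s - shanks_term q n s) + shanks_term q (Suc n) (Suc n)"
    by (simp add: sum_subtractf)
  also have "\<dots> = 1 + (\<Sum>s<Suc n. pent_term q s)"
    by (simp add: Suc.IH shanks_telescope)
       (simp add: shanks_term_def pent_term_def algebra_simps power_add)
  finally show ?case .
qed

text \<open>From 1 + x \<le> exp x and the geometric series; what matters is that the bound depends
  on neither \<open>s\<close> nor \<open>n\<close>.\<close>

lemma norm_prod_one_minus_power_le:
  fixes q :: complex
  assumes "norm q < 1"
  shows "norm (\<Prod>k\<in>{s<..n}. 1 - q ^ k) \<le> exp (1 / (1 - norm q))"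
proof -
  have "norm (\<Prod>k\<in>{s<..n}. 1 - q ^ k) \<le> (\<Prod>k\<in>{s<..n}. exp (norm q ^ k))"
    unfolding prod_norm[symmetric]
  proof (rule prod_mono, safe)
    fix k
    have "norm (1 - q ^ k) \<le> 1 + norm q ^ k"
      by (metis norm_one norm_power norm_triangle_ineq4)
    also have "\<dots> \<le> exp (norm q ^ k)" by (rule exp_ge_add_one_self)
    finally show "norm (1 - q ^ k) \<le> exp (norm q ^ k)" .
  qed auto
  also have "\<dots> = exp (\<Sum>k\<in>{s<..n}. norm q ^ k)" by (simp add: exp_sum)
  also have "(\<Sum>k\<in>{s<..n}. norm q ^ k) \<le> (\<Sum>k. norm q ^ k)"
    using assms by (intro sum_le_suminf summable_geometric) auto
  also have "\<dots> = 1 / (1 - norm q)" using assms by (simp add: suminf_geometric)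
  finally show ?thesis by simp
qed

lemma shanks_remainder_tendsto_0:
  fixes q :: complex
  assumes q: "norm q < 1"
  shows "(\<lambda>n. \<Sum>s\<in>{0<..n}. shanks_term q n s) \<longlonglongrightarrow> 0"
proof (rule Lim_null_comparison)
  define C where "C = exp (1 / (1 - norm q))"
  have "norm (\<Sum>s\<in>{0<..n}. shanks_term q n s) \<le> norm q ^ n * (C / (1 - norm q))" for n
  proof -
    have "norm (\<Sum>s\<in>{0<..n}. shanks_term q n s) \<le> (\<Sum>s\<in>{0<..n}. norm q ^ n * (norm q ^ s * C))"
    proof (rule sum_norm_le)
      fix s assume s: "s \<in> {0<..n}"
      \<comment> \<open>As s \<ge> 1, the exponent is at least n + s: the factor
        \<open>norm q ^ n\<close> makes the remainder vanish, the factor \<open>norm q ^ s\<close>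
        makes it summable.\<close>
      have "norm q ^ (s * n + tri s) \<le> norm q ^ (n + s)"
        using s q le_tri[of s] by (intro power_decreasing) (auto intro!: add_mono)
      then have "norm (shanks_term q n s) \<le> norm q ^ (n + s) * C"
        unfolding shanks_term_def C_def norm_mult
        by (intro mult_mono norm_prod_one_minus_power_le q) (auto simp: norm_power)
      then show "norm (shanks_term q n s) \<le> norm q ^ n * (norm q ^ s * C)"
        by (simp add: power_add mult_ac)
    qed
    also have "\<dots> = norm q ^ n * C * (\<Sum>s\<in>{0<..n}. norm q ^ s)"
      by (simp add: sum_distrib_left mult_ac)
    also have "\<dots> \<le> norm q ^ n * C * (\<Sum>s. norm q ^ s)"
      using q by (intro mult_left_mono sum_le_suminf summable_geometric) (auto simp: C_def)
    also have "\<dots> = norm q ^ n * (C / (1 - norm q))" using q by (simp add: suminf_geometric)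
    finally show ?thesis .
  qed
  then show "\<forall>\<^sub>F n in sequentially. norm (\<Sum>s\<in>{0<..n}. shanks_term q n s) \<le> norm q ^ n * (C / (1 - norm q))"
    by simp
  show "(\<lambda>n. norm q ^ n * (C / (1 - norm q))) \<longlonglongrightarrow> 0"
    using q by (intro tendsto_mult_left_zero LIMSEQ_power_zero) auto
qed

section \<open>Convergence and non-vanishing of the Euler product\<close>

lemma convergent_prod_phi:
  fixes q :: complex
  assumes q: "norm q < 1"
  shows "convergent_prod (\<lambda>k. 1 - q ^ Suc k)"
proof -
  have "summable (\<lambda>k. norm q ^ Suc k)"
    using q summable_geometric[of "norm q"] by (subst summable_Suc_iff) simp
  then have "summable (\<lambda>k. norm ((1 - q ^ Suc k) - 1))"
    by (simp add: norm_power norm_mult)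
  then have "abs_convergent_prod (\<lambda>k. 1 - q ^ Suc k)"
    by (simp add: abs_convergent_prod_conv_summable)
  then show ?thesis by (rule abs_convergent_prod_imp_convergent_prod)
qed

lemma phi_prod_nonzero:
  assumes q: "norm q < 1"
  shows "phi_prod q \<noteq> 0"
  unfolding phi_prod_def
proof (rule prodinf_nonzero[OF convergent_prod_phi[OF q]])
  fix k
  have "norm (q ^ Suc k) \<noteq> 1"
    using q power_less_one_iff[of "norm q" "Suc k"] by (simp add: norm_power del: power_Suc)
  then show "1 - q ^ Suc k \<noteq> 0" by (metis eq_iff_diff_eq_0 norm_one)
qed

lemma pent_term_sums:
  assumes q: "norm q < 1"
  shows "pent_term q sums (phi_prod q - 1)"
proof -
  have "(\<lambda>n. \<Prod>k\<le>n. 1 - q ^ Suc k) \<longlonglongrightarrow> phi_prod q"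
    unfolding phi_prod_def by (rule convergent_prod_LIMSEQ[OF convergent_prod_phi[OF q]])
  then have "(\<lambda>n. \<Prod>k<n. 1 - q ^ Suc k) \<longlonglongrightarrow> phi_prod q"
    by (rule LIMSEQ_lessThan_iff_atMost[THEN iffD2])
  moreover have "(\<Prod>k<n. 1 - q ^ Suc k) = shanks_term q n 0" for n
    unfolding shanks_term_def
    by (simp add: atLeastSucAtMost_greaterThanAtMost[symmetric] prod.atLeast1_atMost_eq del: power_Suc)
  ultimately have "(\<lambda>n. shanks_term q n 0 + (\<Sum>s\<in>{0<..n}. shanks_term q n s) - 1) \<longlonglongrightarrow> phi_prod q + 0 - 1"
    by (intro tendsto_intros shanks_remainder_tendsto_0 q) auto
  moreover have "shanks_term q n 0 + (\<Sum>s\<in>{0<..n}. shanks_term q n s) - 1 = (\<Sum>s<n. pent_term q s)" for n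
  proof -
    have "{..n} = insert 0 {0<..n}" by auto
    then show ?thesis using shanks_identity[of q n] by simp
  qed
  ultimately show ?thesis by (simp add: sums_def)
qed

section \<open>Holomorphy of the Euler product in the unit disc\<close>

lemma norm_pent_term_le:
  assumes "norm (q::complex) \<le> r" "r \<le> 1"
  shows "norm (q ^ (Suc s * s + tri (Suc s))) \<le> r ^ s"
    and "norm (q ^ (Suc s * Suc s + tri (Suc s))) \<le> r ^ s"
    and "norm (pent_term q s) \<le> 2 * r ^ s"
proof -
  have r: "0 \<le> r" using assms norm_ge_zero order_trans by blast
  have *: "norm (q ^ k) \<le> r ^ s" if "s \<le> k" for k
  proof -
    have "norm (q ^ k) \<le> r ^ k" using assms by (simp add: norm_power power_mono)
    also have "\<dots> \<le> r ^ s" using that assms r by (intro power_decreasing) auto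
    finally show ?thesis .
  qed
  show 1: "norm (q ^ (Suc s * s + tri (Suc s))) \<le> r ^ s"
    and 2: "norm (q ^ (Suc s * Suc s + tri (Suc s))) \<le> r ^ s"
    by (rule *; use le_tri[of "Suc s"] in simp)+
  show "norm (pent_term q s) \<le> 2 * r ^ s"
    unfolding pent_term_def norm_mult norm_power[of "-1"] using norm_triangle_mono[OF 1 2] by simp
qed

text \<open>The pentagonal series has a geometric majorant on the disc of radius \<open>r\<close>,
  so it may be differentiated term by term. The derivative at 0 is recorded because the behaviour of
  the modular equation at the cusp depends on it.\<close>

lemma phi_prod_deriv_local:
  assumes "0 < r" "r < 1"
  obtains g' where "\<And>z. norm z < r \<Longrightarrow> (phi_prod has_field_derivative g' z) (at z)" "g' 0 = -1"
proof -
  define D :: "nat \<Rightarrow> complex \<Rightarrow> complex" where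
    "D s z = (-1) ^ Suc s * (of_nat (Suc s * s + tri (Suc s)) * z ^ (Suc s * s + tri (Suc s) - 1) +
       of_nat (Suc s * Suc s + tri (Suc s)) * z ^ (Suc s * Suc s + tri (Suc s) - 1))" for s z
  have "summable (\<lambda>s. 2 * r ^ s)"
    using assms by (intro summable_mult summable_geometric) auto
  moreover have "((\<lambda>z. pent_term z s) has_field_derivative D s z) (at z)" for s z
    unfolding pent_term_def D_def by (rule derivative_eq_intros refl | simp del: tri_Suc)+
  moreover have "\<forall>\<^sub>F s in sequentially. \<forall>z\<in>ball 0 r. norm (pent_term z s :: complex) \<le> 2 * r ^ s"
    using assms by (intro always_eventually ballI allI norm_pent_term_le(3)) auto
  ultimately obtain g g' where "\<forall>z\<in>ball 0 r. (\<lambda>s. pent_term z s) sums g z \<and>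
      (\<lambda>s. D s z) sums g' z \<and> (g has_field_derivative g' z) (at z)"
    by (rule series_and_derivative_comparison[OF open_ball])
  then have g: "\<And>z. z \<in> ball 0 r \<Longrightarrow> (\<lambda>s. pent_term z s) sums g z"
      "\<And>z. z \<in> ball 0 r \<Longrightarrow> (\<lambda>s. D s z) sums g' z"
      "\<And>z. z \<in> ball 0 r \<Longrightarrow> (g has_field_derivative g' z) (at z)"
    by blast+
  have phi: "phi_prod z = g z + 1" if "z \<in> ball 0 r" for z
    using sums_unique2[OF g(1)[OF that] pent_term_sums[of z]] that assms by simp
  have "(phi_prod has_field_derivative g' z) (at z)" if "norm z < r" for z
  proof -
    have "((\<lambda>z. g z + 1) has_field_derivative g' z) (at z)"
      using that by (auto intro!: derivative_eq_intros g(3))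
    then show ?thesis
      by (rule DERIV_cong_ev[THEN iffD1, rotated -1])
         (use that in \<open>auto simp: phi intro!: eventually_nhds_in_open[of "ball 0 r" z, THEN eventually_mono]\<close>)
  qed
  moreover have "g' 0 = -1"
  proof -
    \<comment> \<open>Only -q - q^2, the term \<open>s = 0\<close>, has a linear part; here
      \<open>0 ^ 0 = 1\<close> supplies the value.\<close>
    have "D s 0 = (if s = 0 then -1 else 0)" for s
      by (cases s) (auto simp: D_def power_0_left)
    then have "(\<lambda>s. D s 0) sums -1"
      using sums_single[of 0 "\<lambda>_. - 1 :: complex"] by simp
    then show ?thesis using g(2)[of 0] assms sums_unique2 by auto
  qed
  ultimately show ?thesis using that by blast
qed

lemma phi_prod_deriv_0: "(phi_prod has_field_derivative -1) (at 0)"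
proof -
  obtain g' where "\<And>z. norm z < 1/2 \<Longrightarrow> (phi_prod has_field_derivative g' z) (at z)" "g' 0 = -1"
    using phi_prod_deriv_local[of "1/2"] by auto
  then show ?thesis by (metis half_gt_zero_iff norm_zero zero_less_one)
qed

lemma phi_prod_0 [simp]: "phi_prod 0 = 1"
  by (simp add: phi_prod_def)

lemma phi_prod_holomorphic: "phi_prod holomorphic_on ball 0 1"
proof -
  have "\<exists>g'. (phi_prod has_field_derivative g') (at z)" if "z \<in> ball 0 1" for z
  proof -
    have "norm z < 1" using that by simp
    then obtain r where "norm z < r" "r < 1" using dense by blast
    then show ?thesis using phi_prod_deriv_local[of r] by (metis norm_ge_zero order_le_less_trans)
  qed
  then show ?thesis by (simp add: holomorphic_on_open)
qed

section \<open>The pentagonal series as an unordered sum over the integers\<close>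

lemma has_sum_int_split:
  fixes f :: "int \<Rightarrow> 'a :: topological_ab_group_add"
  assumes "((\<lambda>n. f (int n + 1)) has_sum a) UNIV" "((\<lambda>n. f (- int n - 1)) has_sum b) UNIV"
  shows "(f has_sum (f 0 + (a + b))) UNIV"
proof -
  have "(f has_sum a) (range (\<lambda>n. int n + 1))"
    using assms(1) by (subst has_sum_reindex) (auto simp: o_def inj_on_def)
  moreover have "(f has_sum b) (range (\<lambda>n. - int n - 1))"
    using assms(2) by (subst has_sum_reindex) (auto simp: o_def inj_on_def)
  ultimately have "(f has_sum (a + b)) (range (\<lambda>n. int n + 1) \<union> range (\<lambda>n. - int n - 1))"
    by (rule has_sum_Un_disjoint) auto
  then have "(f has_sum (f 0 + (a + b))) (insert 0 (range (\<lambda>n. int n + 1) \<union> range (\<lambda>n. - int n - 1)))"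
    by (intro has_sum_insert) auto
  moreover have "insert 0 (range (\<lambda>n. int n + 1) \<union> range (\<lambda>n. - int n - 1)) = UNIV"
  proof (intro set_eqI iffI UNIV_I)
    fix x :: int
    have "x \<in> range (\<lambda>n. int n + 1)" if "x > 0"
      by (rule range_eqI[of _ _ "nat (x - 1)"]) (use that in simp)
    moreover have "x \<in> range (\<lambda>n. - int n - 1)" if "x < 0"
      by (rule range_eqI[of _ _ "nat (- x - 1)"]) (use that in simp)
    ultimately show "x \<in> insert 0 (range (\<lambda>n. int n + 1) \<union> range (\<lambda>n. - int n - 1))"
      by (cases "x = 0"; cases "x > 0") auto
  qed
  ultimately show ?thesis by simp
qed

lemma tri_int: "2 * int (tri s) = int s * (int s + 1)"
  by (induction s) (auto simp: algebra_simps)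

text \<open>The positive and the negative indices converge absolutely on their own, so the pairs in
  \<open>pent_term\<close> may be separated and rearranged over all integers.\<close>

lemma phi_prod_has_sum:
  assumes q: "norm q < 1"
  shows "((\<lambda>n::int. (-1) powi n * q powi (n * (3 * n - 1) div 2)) has_sum phi_prod q) UNIV"
proof -
  define a where "a s = (-1) ^ Suc s * q ^ (Suc s * s + tri (Suc s))" for s
  define b where "b s = (-1) ^ Suc s * q ^ (Suc s * Suc s + tri (Suc s))" for s
  have geo: "summable (\<lambda>s. norm q ^ s)" using q by (intro summable_geometric) auto
  have "summable (\<lambda>s. norm (a s))"
    by (rule summable_comparison_test'[OF geo])
       (use norm_pent_term_le(1)[of q "norm q"] q in \<open>auto simp: a_def norm_mult norm_power simp del: tri_Suc\<close>)
  then have a: "(a has_sum suminf a) UNIV" "a sums suminf a"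
    using norm_summable_imp_has_sum summable_norm_cancel summable_sums by blast+
  have "summable (\<lambda>s. norm (b s))"
    by (rule summable_comparison_test'[OF geo])
       (use norm_pent_term_le(2)[of q "norm q"] q in \<open>auto simp: b_def norm_mult norm_power simp del: tri_Suc\<close>)
  then have b: "(b has_sum suminf b) UNIV" "b sums suminf b"
    using norm_summable_imp_has_sum summable_norm_cancel summable_sums by blast+
  have "pent_term q = (\<lambda>s. a s + b s)"
    unfolding pent_term_def a_def b_def by (rule ext) (rule distrib_left)
  then have ab: "suminf a + suminf b = phi_prod q - 1"
    using sums_unique2[OF sums_add[OF a(2) b(2)]] pent_term_sums[OF q] by simp
  define f where "f = (\<lambda>n::int. (-1) powi n * q powi (n * (3 * n - 1) div 2))"
  have ea: "f (int s + 1) = a s" for s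
  proof -
    have "(int s + 1) * (3 * (int s + 1) - 1) = 2 * int (Suc s * s + tri (Suc s))"
      using tri_int[of "Suc s"] by (simp add: algebra_simps)
    then have "(int s + 1) * (3 * (int s + 1) - 1) div 2 = int (Suc s * s + tri (Suc s))" by simp
    moreover have "(-1 :: complex) powi (int s + 1) = (-1) ^ Suc s"
      by (metis Suc_eq_plus1 of_nat_Suc power_int_of_nat add.commute)
    ultimately show ?thesis by (simp only: f_def a_def power_int_of_nat)
  qed
  have eb: "f (- int s - 1) = b s" for s
  proof -
    have "(- int s - 1) * (3 * (- int s - 1) - 1) = 2 * int (Suc s * Suc s + tri (Suc s))"
      using tri_int[of "Suc s"] by (simp add: algebra_simps)
    then have "(- int s - 1) * (3 * (- int s - 1) - 1) div 2 = int (Suc s * Suc s + tri (Suc s))" by simp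
    moreover have "(-1 :: complex) powi (- int s - 1) = (-1) ^ Suc s"
    proof -
      have "(-1 :: complex) powi (- int (Suc s)) = (-1) ^ Suc s"
        by (subst power_int_minus) (simp add: power_inverse[symmetric] del: of_nat_Suc)
      moreover have "- int s - 1 = - int (Suc s)" by simp
      ultimately show ?thesis by (simp only:)
    qed
    ultimately show ?thesis by (simp only: f_def b_def power_int_of_nat)
  qed
  have "(f has_sum (f 0 + (suminf a + suminf b))) UNIV"
    by (rule has_sum_int_split) (use a b in \<open>simp_all add: ea eb\<close>)
  then show ?thesis by (simp add: ab) (simp add: f_def)
qed

text \<open>Two signs cancel: \<open>f_sub\<close> passes \<open>- (q ^ n)\<close> to a series that
  negates its argument.\<close>

lemma f_sub_eq_phi_prod:
  assumes "norm q < 1" "n > 0"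
  shows "f_sub q n = phi_prod (q ^ n)"
proof -
  have "norm (q ^ n) < 1" using assms
    by (simp add: norm_power power_less_one_iff)
  from phi_prod_has_sum[OF this] show ?thesis
    by (simp add: f_sub_def ramanujan_f_def infsumI)
qed

section \<open>Uniqueness of Fourier coefficients\<close>

text \<open>On the circle a linear functional is a combination of the frequencies 1 and -1, so
  multiplying by it shifts \<open>k\<close> by one. For a product the hypothesis on the second
  factor is applied to \<open>D\<close> times the first factor, which is why \<open>D\<close> and
  \<open>k\<close> vary in the induction.\<close>

lemma orthogonal_mult_real_polynomial:
  fixes D :: "real \<Rightarrow> complex"
  assumes "real_polynomial_function g"
    and "continuous_on UNIV D"
    and "\<And>k::int. integral {0..1} (\<lambda>x. D x * cis (2 * pi * of_int k * x)) = 0"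
  shows "integral {0..1} (\<lambda>x. D x * of_real (g (cis (2 * pi * x))) * cis (2 * pi * of_int k * x)) = 0"
  using assms
proof (induction g arbitrary: D k rule: real_polynomial_function.induct)
  case (linear f)
  interpret bounded_linear f by fact
  \<comment> \<open>With these values f(1) cos t + f(i) sin t = a e^(it) + b e^(-it).\<close>
  define a b where "a = (of_real (f 1) - \<i> * of_real (f \<i>)) / 2"
    and "b = (of_real (f 1) + \<i> * of_real (f \<i>)) / 2"
  have cont: "continuous_on A D" for A
    using linear.prems(1) continuous_on_subset by blast
  have I: "((\<lambda>x. D x * cis (2 * pi * of_int j * x)) has_integral 0) {0..1}" for j :: int
    by (subst linear.prems(2)[of j, symmetric])
       (intro integrable_integral integrable_continuous_real continuous_intros cont)
  have "D x * of_real (f (cis (2 * pi * x))) * cis (2 * pi * of_int k * x) =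
      a * (D x * cis (2 * pi * of_int (k + 1) * x)) + b * (D x * cis (2 * pi * of_int (k - 1) * x))" for x
  proof -
    have "f (cis (2 * pi * x)) = f (cos (2 * pi * x) *\<^sub>R 1 + sin (2 * pi * x) *\<^sub>R \<i>)"
      by (intro arg_cong[of _ _ f] complex_eqI) auto
    also have "\<dots> = cos (2 * pi * x) * f 1 + sin (2 * pi * x) * f \<i>"
      by (simp only: add scaleR) simp
    finally have "of_real (f (cis (2 * pi * x))) = a * cis (2 * pi * x) + b * cis (- (2 * pi * x))"
      by (intro complex_eqI) (simp_all add: a_def b_def field_simps)
    moreover have "cis (2 * pi * of_int (k + 1) * x) = cis (2 * pi * x) * cis (2 * pi * of_int k * x)"
      "cis (2 * pi * of_int (k - 1) * x) = cis (- (2 * pi * x)) * cis (2 * pi * of_int k * x)"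
      by (simp_all add: cis_mult algebra_simps)
    ultimately show ?thesis by (simp add: algebra_simps)
  qed
  moreover have "((\<lambda>x. a * (D x * cis (2 * pi * of_int (k + 1) * x)) + b * (D x * cis (2 * pi * of_int (k - 1) * x)))
      has_integral (a * 0 + b * 0)) {0..1}"
    by (intro has_integral_add has_integral_mult_right I)
  ultimately show ?case by (simp add: integral_unique)
next
  case (const c)
  have "((\<lambda>x. D x * cis (2 * pi * of_int k * x) * of_real c) has_integral 0 * of_real c) {0..1}"
    unfolding const.prems(2)[of k, symmetric]
    by (intro has_integral_mult_left integrable_integral integrable_continuous_real continuous_intros
        continuous_on_subset[OF const.prems(1)]) auto
  then show ?case by (simp add: integral_unique mult_ac)
next
  case (add f g)
  have cont: "continuous_on A (\<lambda>x. h (cis (2 * pi * x)))" if "real_polynomial_function h" for h :: "complex \<Rightarrow> real" and A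
    using that by (intro continuous_on_compose2[OF continuous_on_polymonial_function[of h UNIV]]
        continuous_intros) (auto simp: real_polynomial_function_eq)
  have D: "continuous_on A D" for A
    using add.prems(1) continuous_on_subset by blast
  have "((\<lambda>x. D x * of_real (f (cis (2 * pi * x))) * cis (2 * pi * of_int k * x) +
       D x * of_real (g (cis (2 * pi * x))) * cis (2 * pi * of_int k * x)) has_integral 0 + 0) {0..1}"
    using add.IH(1)[OF add.prems, of k] add.IH(2)[OF add.prems, of k]
    by (intro has_integral_add; simp only: has_integral_iff)
       (intro conjI integrable_continuous_real continuous_intros cont D add.hyps; simp)+
  then show ?case by (simp add: integral_unique algebra_simps)
next
  case (mult f g)
  have cont: "continuous_on UNIV (\<lambda>x. D x * of_real (f (cis (2 * pi * x))))"
    using mult.hyps mult.prems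
    by (intro continuous_intros continuous_on_compose2[OF continuous_on_polymonial_function[of f UNIV]])
       (auto simp: real_polynomial_function_eq)
  show ?case
    using mult.IH(2)[OF cont mult.IH(1)[OF mult.prems], of k] by (simp add: mult_ac)
qed

lemma periodic_of_int:
  fixes D :: "real \<Rightarrow> 'a"
  assumes "\<And>x. D (x + 1) = D x"
  shows "D (x + of_int n) = D x"
proof (induction n rule: int_induct[of _ 0])
  case (step1 i)
  then show ?case using assms[of "x + of_int i"] by (simp add: add_ac)
next
  case (step2 i)
  then show ?case using assms[of "x + of_int (i - 1)"] by (simp add: add_ac)
qed auto

text \<open>\<open>d\<close> is \<open>D\<close> composed with \<open>Arg / (2 * pi)\<close>. At the
  cut of \<open>Arg\<close> continuity is obtained from \<open>Arg2pi\<close>, whose cut is the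
  positive axis and which, by periodicity of \<open>D\<close>, defines the same function on the
  circle.\<close>

lemma periodic_factor_through_circle:
  fixes D :: "real \<Rightarrow> 'a::topological_space"
  assumes D: "continuous_on UNIV D" and per: "\<And>x. D (x + 1) = D x"
  obtains d where "continuous_on (sphere 0 1) d" "\<And>x. d (cis (2 * pi * x)) = D x"
proof -
  define d where "d z = D (Arg z / (2 * pi))" for z
  have dD: "d (cis (2 * pi * x)) = D x" for x
  proof -
    have "cis (Arg (cis (2 * pi * x))) = cis (2 * pi * x)"
      by (subst cis_Arg) auto
    then obtain n :: int where "Arg (cis (2 * pi * x)) = 2 * pi * x + of_int n * (2 * pi)"
      unfolding cis_conv_exp exp_eq by (auto simp: complex_eq_iff)
    then have "Arg (cis (2 * pi * x)) / (2 * pi) = x + of_int n"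
      by (simp add: field_simps)
    then show ?thesis unfolding d_def using periodic_of_int[of D, OF per] by simp
  qed
  have cont: "isCont D x" for x using D by (simp add: continuous_on_eq_continuous_at)
  have "continuous (at z within sphere 0 1) d" if z: "z \<in> sphere 0 1" for z
  proof (cases "z \<in> \<real>\<^sub>\<le>\<^sub>0")
    case False
    have "isCont (\<lambda>z. Arg z / (2 * pi)) z"
      by (intro continuous_intros continuous_at_Arg False) auto
    then have "isCont d z" unfolding d_def by (rule isCont_o2[OF _ cont])
    then show ?thesis using continuous_at_imp_continuous_at_within by blast
  next
    case True
    then have "z \<notin> \<real>\<^sub>\<ge>\<^sub>0" using z
      by (auto simp: complex_nonneg_Reals_iff complex_nonpos_Reals_iff) (metis antisym complex_eqI norm_zero zero_complex.sel zero_neq_one)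
    then have "isCont (\<lambda>z. Arg2pi z / (2 * pi)) z"
      by (intro continuous_intros continuous_at_Arg2pi) auto
    then have "isCont (\<lambda>z. D (Arg2pi z / (2 * pi))) z" by (rule isCont_o2[OF _ cont])
    then have "continuous (at z within sphere 0 1) (\<lambda>z. D (Arg2pi z / (2 * pi)))"
      using continuous_at_imp_continuous_at_within by blast
    moreover have "D (Arg2pi u / (2 * pi)) = d u" if "u \<in> sphere 0 1" for u
    proof -
      have "u = cis (2 * pi * (Arg2pi u / (2 * pi)))"
        using Arg2pi_eq[of u] that by (simp add: cis_conv_exp mult_ac)
      then show ?thesis using dD by metis
    qed
    ultimately show ?thesis using z
      by (elim continuous_transform_within[OF _ zero_less_one]) auto
  qed
  then have "continuous_on (sphere 0 1) d" by (simp add: continuous_on_eq_continuous_within)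
  then show ?thesis using that dD by blast
qed

text \<open>Let u = Re D and let h be a real trigonometric polynomial within e of u. Orthogonality
  gives that u h has integral 0, so the integral of u^2 equals that of u (u - h) and is at most e
  times the integral of |u|.\<close>

lemma Re_eq_0_if_orthogonal:
  fixes D :: "real \<Rightarrow> complex"
  assumes D: "continuous_on UNIV D" and per: "\<And>x. D (x + 1) = D x"
    and orth: "\<And>k::int. integral {0..1} (\<lambda>x. D x * cis (2 * pi * of_int k * x)) = 0"
  shows "Re (D x) = 0"
proof -
  define u where "u x = Re (D x)" for x
  have u: "continuous_on A u" for A
    unfolding u_def by (intro continuous_intros continuous_on_subset[OF D]) auto
  obtain d where d: "continuous_on (sphere 0 1) d" "\<And>x. d (cis (2 * pi * x)) = u x"
    using periodic_factor_through_circle[OF u] per unfolding u_def by metis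
  define B where "B = integral {0..1} (\<lambda>x. \<bar>u x\<bar>)"
  have B: "B \<ge> 0" unfolding B_def by (rule integral_nonneg) (auto intro!: integrable_continuous_real continuous_intros u)
  have le: "integral {0..1} (\<lambda>x. u x ^ 2) \<le> e * B" if "e > 0" for e
  proof -
    obtain g where g: "real_polynomial_function g" "\<And>z. z \<in> sphere 0 1 \<Longrightarrow> \<bar>d z - g z\<bar> < e"
      by (rule Stone_Weierstrass_real_polynomial_function[OF compact_sphere d(1) \<open>e > 0\<close>]) blast
    define h where "h x = g (cis (2 * pi * x))" for x
    have h: "continuous_on A h" for A
      unfolding h_def
      by (intro continuous_intros continuous_on_compose2[OF continuous_on_polymonial_function[of g UNIV]])
         (use g in \<open>auto simp: real_polynomial_function_eq\<close>)
    have uh: "\<bar>u x - h x\<bar> < e" for x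
      using g(2)[of "cis (2 * pi * x)"] d(2)[of x] by (simp add: h_def)
    have "integral {0..1} (\<lambda>x. D x * of_real (h x)) = 0"
      using orthogonal_mult_real_polynomial[OF g(1) D orth, of 0] by (simp add: h_def)
    then have "((\<lambda>x. D x * of_real (h x)) has_integral 0) {0..1}"
      by (metis integrable_integral integrable_continuous_real continuous_on_mult continuous_on_of_real h
          continuous_on_subset D subset_UNIV)
    \<comment> \<open>As \<open>h\<close> is real, the real part of D h is u h.\<close>
    then have "((\<lambda>x. Re (D x * of_real (h x))) has_integral Re 0) {0..1}"
      by (rule has_integral_Re)
    then have uh0: "((\<lambda>x. u x * h x) has_integral 0) {0..1}" by (simp add: u_def)
    have int: "((\<lambda>x. u x ^ 2) has_integral integral {0..1} (\<lambda>x. u x ^ 2)) {0..1}"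
      by (intro integrable_integral integrable_continuous_real continuous_intros u)
    have i1: "((\<lambda>x. u x ^ 2 - u x * h x) has_integral integral {0..1} (\<lambda>x. u x ^ 2)) {0..1}"
      using has_integral_diff[OF int uh0] by simp
    have i2: "((\<lambda>x. e * \<bar>u x\<bar>) has_integral e * B) {0..1}"
      unfolding B_def
      by (intro has_integral_mult_right integrable_integral integrable_continuous_real continuous_intros u)
    show ?thesis
    proof (rule has_integral_le[OF i1 i2])
      fix x
      have "u x ^ 2 - u x * h x = u x * (u x - h x)" by (simp add: power2_eq_square algebra_simps)
      also have "\<dots> \<le> \<bar>u x\<bar> * \<bar>u x - h x\<bar>" by (metis abs_ge_self abs_mult)
      also have "\<dots> \<le> \<bar>u x\<bar> * e" using uh[of x] by (intro mult_left_mono) auto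
      finally show "u x ^ 2 - u x * h x \<le> e * \<bar>u x\<bar>" by (simp add: mult_ac)
    qed
  qed
  have "integral {0..1} (\<lambda>x. u x ^ 2) \<le> 0"
  proof (rule field_le_epsilon)
    fix e :: real assume "e > 0"
    \<comment> \<open>The denominator B + 1 rather than B covers the case B = 0.\<close>
    have "integral {0..1} (\<lambda>x. u x ^ 2) \<le> e / (B + 1) * B" using \<open>e > 0\<close> B by (intro le) auto
    also have "\<dots> \<le> e" using \<open>e > 0\<close> B by (simp add: field_simps)
    finally show "integral {0..1} (\<lambda>x. u x ^ 2) \<le> 0 + e" by simp
  qed
  moreover have "integral {0..1} (\<lambda>x. u x ^ 2) \<ge> 0"
    by (intro integral_nonneg integrable_continuous_real continuous_intros u) auto
  ultimately have "integral {0..1} (\<lambda>x. u x ^ 2) = 0" by simp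
  then have "\<forall>x\<in>{0..1}. u x ^ 2 = 0"
    by (subst (asm) integral_eq_0_iff) (auto intro!: continuous_intros u)
  then have "u (frac x) = 0" by (auto simp: frac_lt_1 less_imp_le)
  moreover have "u (frac x) = u x"
    using periodic_of_int[of u "frac x" "\<lfloor>x\<rfloor>"] per by (simp add: u_def frac_def)
  ultimately show ?thesis by (simp add: u_def)
qed

lemma eq_0_if_orthogonal:
  fixes D :: "real \<Rightarrow> complex"
  assumes D: "continuous_on UNIV D" and per: "\<And>x. D (x + 1) = D x"
    and orth: "\<And>k::int. integral {0..1} (\<lambda>x. D x * cis (2 * pi * of_int k * x)) = 0"
  shows "D x = 0"
proof (rule complex_eqI)
  show "Re (D x) = Re 0" using Re_eq_0_if_orthogonal[OF assms] by simp
  have "integral {0..1} (\<lambda>x. \<i> * D x * cis (2 * pi * of_int k * x)) = 0" for k :: int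
    using orth[of k] by (simp add: mult.assoc)
  then have "Re (\<i> * D x) = 0"
    by (intro Re_eq_0_if_orthogonal continuous_intros D) (auto simp: per)
  then show "Im (D x) = Im 0" by simp
qed

text \<open>The Weierstrass test on each interval from -X to X gives locally uniform convergence,
  hence continuity of the sum and exchange of sum and integral. The majorant may depend on
  \<open>X\<close>, since that of a sum of shifted Gaussians grows with the interval.\<close>

lemma int_series_integral:
  fixes f :: "int \<Rightarrow> real \<Rightarrow> complex" and M :: "real \<Rightarrow> int \<Rightarrow> real"
  assumes cont: "\<And>k. continuous_on UNIV (f k)"
    and bound: "\<And>k x X. \<bar>x\<bar> \<le> X \<Longrightarrow> norm (f k x) \<le> M X k"
    and M: "\<And>X. M X summable_on UNIV"
  shows "((\<lambda>k. f k x) has_sum (\<Sum>\<^sub>\<infinity>k. f k x)) UNIV"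
    and "continuous_on UNIV (\<lambda>x. \<Sum>\<^sub>\<infinity>k. f k x)"
    and "((\<lambda>k. integral {0..1} (\<lambda>x. f k x * cis (c * x))) has_sum
           integral {0..1} (\<lambda>x. (\<Sum>\<^sub>\<infinity>k. f k x) * cis (c * x))) UNIV"
proof -
  have ul: "uniform_limit {-X..X} (\<lambda>F x. \<Sum>k\<in>F. f k x) (\<lambda>x. \<Sum>\<^sub>\<infinity>k. f k x) (finite_subsets_at_top UNIV)" for X
    by (rule Weierstrass_m_test_general[OF bound[of _ X] M]) auto
  have "((\<lambda>F. \<Sum>k\<in>F. f k x) \<longlongrightarrow> (\<Sum>\<^sub>\<infinity>k. f k x)) (finite_subsets_at_top UNIV)"
    by (rule tendsto_uniform_limitI[OF ul[of "\<bar>x\<bar>"]]) auto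
  then show "((\<lambda>k. f k x) has_sum (\<Sum>\<^sub>\<infinity>k. f k x)) UNIV" by (simp add: has_sum_def)
  have contX: "continuous_on {-X..X} (\<lambda>x. \<Sum>\<^sub>\<infinity>k. f k x)" for X
    by (rule uniform_limit_theorem[OF _ ul])
       (auto intro!: always_eventually continuous_intros continuous_on_subset[OF cont])
  show cont_sum: "continuous_on UNIV (\<lambda>x. \<Sum>\<^sub>\<infinity>k. f k x)"
    unfolding continuous_on_eq_continuous_at[OF open_UNIV]
  proof
    fix x :: real
    have "x \<in> interior {- (\<bar>x\<bar> + 1)..\<bar>x\<bar> + 1}" by auto
    then show "isCont (\<lambda>x. \<Sum>\<^sub>\<infinity>k. f k x) x"
      using continuous_on_interior[OF contX] by blast
  qed
  have "uniform_limit {0..1} (\<lambda>F x. \<Sum>k\<in>F. f k x) (\<lambda>x. \<Sum>\<^sub>\<infinity>k. f k x) (finite_subsets_at_top UNIV)"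
    by (rule uniform_limit_on_subset[OF ul[of 1]]) auto
  then have "uniform_limit {0..1} (\<lambda>F x. (\<Sum>k\<in>F. f k x) * cis (c * x)) (\<lambda>x. (\<Sum>\<^sub>\<infinity>k. f k x) * cis (c * x))
      (finite_subsets_at_top UNIV)"
    by (intro uniform_lim_mult uniform_limit_const compact_imp_bounded compact_continuous_image
        continuous_intros continuous_on_subset[OF cont_sum]) auto
  then obtain I J where IJ: "\<And>F. ((\<lambda>x. (\<Sum>k\<in>F. f k x) * cis (c * x)) has_integral I F) {0..1}"
    "((\<lambda>x. (\<Sum>\<^sub>\<infinity>k. f k x) * cis (c * x)) has_integral J) {0..1}"
    "(I \<longlongrightarrow> J) (finite_subsets_at_top UNIV)"
    by (rule uniform_limit_integral) (auto intro!: continuous_intros continuous_on_subset[OF cont])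
  have "I F = (\<Sum>k\<in>F. integral {0..1} (\<lambda>x. f k x * cis (c * x)))" if "finite F" for F
  proof -
    have "((\<lambda>x. \<Sum>k\<in>F. f k x * cis (c * x)) has_integral (\<Sum>k\<in>F. integral {0..1} (\<lambda>x. f k x * cis (c * x)))) {0..1}"
      by (intro has_integral_sum that integrable_integral integrable_continuous_real continuous_intros
          continuous_on_subset[OF cont]) auto
    then show ?thesis using IJ(1)[of F] has_integral_unique by (simp add: sum_distrib_right)
  qed
  then have "((\<lambda>F. \<Sum>k\<in>F. integral {0..1} (\<lambda>x. f k x * cis (c * x))) \<longlongrightarrow> J) (finite_subsets_at_top UNIV)"
    by (intro Lim_transform_eventually[OF IJ(3)] eventually_finite_subsets_at_top_weakI) auto
  then show "((\<lambda>k. integral {0..1} (\<lambda>x. f k x * cis (c * x))) has_sum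
           integral {0..1} (\<lambda>x. (\<Sum>\<^sub>\<infinity>k. f k x) * cis (c * x))) UNIV"
    using integral_unique[OF IJ(2)] by (simp add: has_sum_def)
qed

section \<open>Poisson summation for the Gaussian\<close>

lemma summable_on_power_abs_int:
  fixes r :: real
  assumes "0 \<le> r" "r < 1"
  shows "(\<lambda>n::int. r ^ nat \<bar>n\<bar>) summable_on UNIV"
proof -
  have "(\<lambda>n. r ^ Suc n) summable_on UNIV"
    using assms by (intro summable_nonneg_imp_summable_on) (auto intro!: summable_mult)
  then obtain s where "((\<lambda>n. r ^ Suc n) has_sum s) UNIV" by (auto simp: summable_on_def)
  moreover have "nat \<bar>int n + 1\<bar> = Suc n" "nat \<bar>- int n - 1\<bar> = Suc n" for n by auto
  ultimately have "((\<lambda>n::int. r ^ nat \<bar>n\<bar>) has_sum (r ^ nat \<bar>0\<bar> + (s + s))) UNIV"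
    by (intro has_sum_int_split) auto
  then show ?thesis by (rule has_sum_imp_summable)
qed

lemma exp_neg_square_le:
  fixes c x X :: real and n :: int
  assumes "c \<ge> 0" "\<bar>x\<bar> \<le> X"
  shows "exp (- c * (x + of_int n)\<^sup>2) \<le> exp (c * X\<^sup>2) * exp (- c / 2) ^ nat \<bar>n\<bar>"
proof -
  have "\<bar>n\<bar> * 1 \<le> \<bar>n\<bar> * \<bar>n\<bar>"
  proof (cases "n = 0")
    case False
    then have "1 \<le> \<bar>n\<bar>" by linarith
    then show ?thesis by (intro mult_left_mono) auto
  qed simp
  then have "\<bar>n\<bar> \<le> n\<^sup>2" by (simp add: power2_eq_square)
  then have n: "real_of_int \<bar>n\<bar> \<le> (of_int n)\<^sup>2"
    by (metis of_int_le_iff of_int_power)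
  \<comment> \<open>This is (2x + n)^2 \<ge> 0 rearranged.\<close>
  have "(of_int n)\<^sup>2 \<le> 2 * (x + of_int n)\<^sup>2 + 2 * x\<^sup>2"
    using zero_le_power2[of "2 * x + of_int n"] by (simp add: power2_eq_square algebra_simps)
  moreover have "x\<^sup>2 \<le> X\<^sup>2" using assms by (simp add: abs_le_square_iff[symmetric])
  moreover have "a / 2 - e \<le> c" if "a \<le> b" "b \<le> 2 * c + 2 * d" "d \<le> e" for a b c d e :: real
    using that by linarith
  ultimately have "of_int \<bar>n\<bar> / 2 - X\<^sup>2 \<le> (x + of_int n)\<^sup>2" using n by blast
  then have "c * (of_int \<bar>n\<bar> / 2 - X\<^sup>2) \<le> c * (x + of_int n)\<^sup>2"
    using assms by (intro mult_left_mono) auto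
  then have "exp (- c * (x + of_int n)\<^sup>2) \<le> exp (c * X\<^sup>2 + of_nat (nat \<bar>n\<bar>) * (- c / 2))"
    by (simp add: algebra_simps)
  also have "\<dots> = exp (c * X\<^sup>2) * exp (- c / 2) ^ nat \<bar>n\<bar>"
    by (simp only: exp_add exp_of_nat_mult)
  finally show ?thesis .
qed

text \<open>Substituting y = sqrt(2 pi t) x turns the integral into the characteristic function of
  the standard normal distribution at 2 pi k / sqrt(2 pi t).\<close>

lemma gaussian_fourier_transform:
  fixes t k :: real
  assumes t: "t > 0"
  shows "integrable lborel (\<lambda>x. of_real (exp (- (pi * t) * x\<^sup>2)) * cis (2 * pi * k * x))"
    and "(LINT x|lborel. of_real (exp (- (pi * t) * x\<^sup>2)) * cis (2 * pi * k * x)) =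
           of_real (exp (- (pi / t) * k\<^sup>2) / sqrt t)"
proof -
  define \<sigma> where "\<sigma> = sqrt (2 * pi * t)"
  have \<sigma>: "\<sigma> > 0" "\<sigma>\<^sup>2 = 2 * pi * t" "\<sigma> = sqrt (2 * pi) * sqrt t"
    using t by (auto simp: \<sigma>_def real_sqrt_mult power_mult_distrib)
  define s where "s = 2 * pi * k / \<sigma>"
  define f where "f = (\<lambda>y. std_normal_density y *\<^sub>R iexp (s * y))"
  have int: "integrable lborel f"
    unfolding f_def
    by (rule Bochner_Integration.integrable_bound[OF integrable_normal_density[of 1 0]]) auto
  have f: "(LINT y|lborel. f y) = of_real (exp (- s\<^sup>2 / 2))"
    using char_std_normal_distribution unfolding char_def f_def
    by (subst integral_density[symmetric]) (auto simp: fun_eq_iff)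
  have f_affine: "f (0 + \<sigma> * x) = of_real (1 / sqrt (2 * pi)) *
      (of_real (exp (- (pi * t) * x\<^sup>2)) * cis (2 * pi * k * x))" for x
  proof -
    have "s * (\<sigma> * x) = 2 * pi * k * x" using \<sigma>(1) by (simp add: s_def)
    then have 1: "iexp (s * (\<sigma> * x)) = cis (2 * pi * k * x)" by (simp only: cis_conv_exp)
    have 2: "- (\<sigma> * x)\<^sup>2 / 2 = - (pi * t) * x\<^sup>2" by (simp add: power_mult_distrib \<sigma> less_imp_le[OF t])
    show ?thesis
      unfolding f_def add_0 1 std_normal_density_def 2 by (simp add: scaleR_conv_of_real)
  qed
  have "integrable lborel (\<lambda>x. of_real (sqrt (2 * pi)) * f (0 + \<sigma> * x))"
    using \<sigma> by (intro integrable_mult_right lborel_integrable_real_affine int) auto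
  moreover have "of_real (sqrt (2 * pi)) * (of_real (1 / sqrt (2 * pi)) * z) = z" for z :: complex
    by (simp add: field_simps)
  ultimately show "integrable lborel (\<lambda>x. of_real (exp (- (pi * t) * x\<^sup>2)) * cis (2 * pi * k * x))"
    by (simp only: f_affine)
  have "of_real (exp (- s\<^sup>2 / 2)) = \<sigma> *\<^sub>R (LINT x|lborel. f (0 + \<sigma> * x))"
    using lborel_integral_real_affine[of \<sigma> f 0] \<sigma>(1) f by simp
  also have "\<dots> = of_real (sqrt t) *
      (LINT x|lborel. of_real (exp (- (pi * t) * x\<^sup>2)) * cis (2 * pi * k * x))"
    unfolding f_affine using \<sigma> by (simp add: scaleR_conv_of_real)
  finally have "(LINT x|lborel. of_real (exp (- (pi * t) * x\<^sup>2)) * cis (2 * pi * k * x)) =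
      of_real (exp (- s\<^sup>2 / 2) / sqrt t)"
    using t by (simp add: field_simps)
  moreover have "s\<^sup>2 / 2 = pi / t * k\<^sup>2"
    using t by (simp add: s_def power_divide power_mult_distrib \<sigma>) (simp add: field_simps power2_eq_square)
  ultimately show "(LINT x|lborel. of_real (exp (- (pi * t) * x\<^sup>2)) * cis (2 * pi * k * x)) =
           of_real (exp (- (pi / t) * k\<^sup>2) / sqrt t)"
    by simp
qed

lemma integral_symmetric_intervals_tendsto:
  fixes f :: "real \<Rightarrow> complex"
  assumes "integrable lborel f"
  shows "(\<lambda>N. integral {- real N..real N} f) \<longlonglongrightarrow> (LINT x|lborel. f x)"
proof -
  have "(\<lambda>N. LINT x|lborel. indicator {- real N..real N} x *\<^sub>R f x) \<longlonglongrightarrow> (LINT x|lborel. f x)"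
  proof (rule integral_dominated_convergence[where w = "\<lambda>x. norm (f x)"])
    show "integrable lborel (\<lambda>x. norm (f x))" using assms by auto
    show "AE x in lborel. (\<lambda>N. indicator {- real N..real N} x *\<^sub>R f x) \<longlonglongrightarrow> f x"
    proof (rule AE_I2)
      fix x :: real
      obtain N0 where N0: "\<bar>x\<bar> \<le> real N0" using real_arch_simple by blast
      have "\<forall>\<^sub>F N in sequentially. indicator {- real N..real N} x *\<^sub>R f x = f x"
        using eventually_ge_at_top[of N0] by eventually_elim (use N0 in \<open>auto simp: indicator_def\<close>)
      then show "(\<lambda>N. indicator {- real N..real N} x *\<^sub>R f x) \<longlonglongrightarrow> f x"
        by (rule tendsto_eventually)
    qed
  qed (use assms in \<open>auto simp: indicator_def intro!: AE_I2\<close>)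
  moreover have "(LINT x|lborel. indicator {- real N..real N} x *\<^sub>R f x) = integral {- real N..real N} f" for N
    using set_borel_integral_eq_integral(2)[of "{- real N..real N}" f] assms
    by (simp add: set_integrable_def set_lebesgue_integral_def integrable_mult_indicator)
  ultimately show ?thesis by simp
qed

text \<open>The unit intervals that start at -N, ..., N - 1 tile the interval from -N to N, hence
  the half-open index set.\<close>

lemma integral_symmetric_interval_sum:
  fixes f :: "real \<Rightarrow> complex"
  assumes "continuous_on UNIV f"
  shows "integral {- real N..real N} f = (\<Sum>n\<in>{- int N..<int N}. integral {0..1} (\<lambda>x. f (x + of_int n)))"
proof (induction N)
  case (Suc N)
  have int: "f integrable_on {a..b}" for a b
    by (intro integrable_continuous_real continuous_on_subset[OF assms]) auto
  have shift: "integral {0..1} (\<lambda>x. f (x + c)) = integral {c..c + 1} f" for c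
    using integral_shift[of 0 c 1 f] continuous_on_subset[OF assms] by (simp add: o_def add_ac)
  have set: "{- int (Suc N)..<int (Suc N)} = insert (- int N - 1) (insert (int N) {- int N..<int N})" by auto
  have ends: "- real (Suc N) = - real N - 1" "real (Suc N) = real N + 1" by simp_all
  have "integral {- real (Suc N)..real (Suc N)} f =
      integral {- real N - 1..- real N} f + integral {- real N..real N} f + integral {real N..real N + 1} f"
    using Henstock_Kurzweil_Integration.integral_combine[of "- real N - 1" "- real N" "real N" f]
      Henstock_Kurzweil_Integration.integral_combine[of "- real N - 1" "real N" "real N + 1" f] int
    unfolding ends
    by simp
  then show ?case
    unfolding set using Suc.IH by (simp add: shift algebra_simps)
qed auto

text \<open>Allows an unordered sum over the integers to be evaluated along the index sets whose
  unit intervals join to one integral.\<close>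

lemma filterlim_symmetric_int_intervals:
  "filterlim (\<lambda>N. {- int N..<int N}) (finite_subsets_at_top UNIV) sequentially"
  unfolding filterlim_finite_subsets_at_top
proof (intro allI impI)
  fix X :: "int set" assume X: "finite X \<and> X \<subseteq> UNIV"
  define N0 where "N0 = nat (Max (insert 0 (abs ` X))) + 1"
  have "x \<in> {- int N..<int N}" if "x \<in> X" "N \<ge> N0" for x N
  proof -
    have "\<bar>x\<bar> \<le> Max (insert 0 (abs ` X))" using X that by (intro Max_ge) auto
    then show ?thesis using that unfolding N0_def by auto
  qed
  then show "\<forall>\<^sub>F N in sequentially. finite {- int N..<int N} \<and> X \<subseteq> {- int N..<int N} \<and> {- int N..<int N} \<subseteq> UNIV"
    by (intro eventually_mono[OF eventually_ge_at_top[of N0]]) auto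
qed

lemma integral_cis_orthogonal:
  fixes m :: int
  shows "integral {0..1} (\<lambda>x. cis (2 * pi * of_int m * x)) = (if m = 0 then 1 else 0)"
proof (cases "m = 0")
  case False
  define c where "c = 2 * pi * \<i> * of_int m"
  have "c \<noteq> 0" using False by (simp add: c_def)
  have e: "cis (2 * pi * of_int m * x) = exp (c * of_real x)" for x
    by (simp add: cis_conv_exp c_def mult_ac)
  have "((\<lambda>x. exp (c * of_real x)) has_integral (exp (c * of_real 1) / c - exp (c * of_real 0) / c)) {0..1}"
    using \<open>c \<noteq> 0\<close>
    by (intro fundamental_theorem_of_calculus)
       (auto intro!: derivative_eq_intros has_vector_derivative_real_field simp: has_real_derivative_iff_has_vector_derivative[symmetric])
  moreover have "exp c = 1"
    unfolding c_def exp_eq_1 by (auto intro: exI[of _ m])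
  ultimately show ?thesis using False by (simp add: e integral_unique)
qed simp

text \<open>Both series define continuous functions of period 1, and both have the Fourier
  coefficients \<open>a k\<close>, so they agree. For the Gaussian side the coefficient unfolds to
  an integral over the whole line; for the other side it is read off by orthogonality.\<close>

lemma poisson_gaussian:
  fixes t x :: real
  assumes t: "t > 0"
  obtains G where
    "((\<lambda>n::int. of_real (exp (- (pi * t) * (x + of_int n)\<^sup>2))) has_sum (G :: complex)) UNIV"
    "((\<lambda>k::int. of_real (exp (- (pi / t) * (of_int k)\<^sup>2) / sqrt t) * cis (2 * pi * of_int k * x)) has_sum G) UNIV"
proof -
  define f where "f n x = complex_of_real (exp (- (pi * t) * (x + of_int n)\<^sup>2))" for n :: int and x
  define a where "a k = exp (- (pi / t) * (of_int k)\<^sup>2) / sqrt t" for k :: int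
  define h where "h k x = complex_of_real (a k) * cis (2 * pi * of_int k * x)" for k :: int and x
  have f_cont: "continuous_on UNIV (f n)" for n
    unfolding f_def by (intro continuous_intros)
  have f_bound: "norm (f n x) \<le> exp (pi * t * X\<^sup>2) * exp (- (pi * t) / 2) ^ nat \<bar>n\<bar>" if "\<bar>x\<bar> \<le> X" for n x X
    using exp_neg_square_le[of "pi * t" x X n] t that by (simp add: f_def)
  have f_sum: "(\<lambda>n::int. exp (pi * t * X\<^sup>2) * exp (- (pi * t) / 2) ^ nat \<bar>n\<bar>) summable_on UNIV" for X
    using t by (intro summable_on_cmult_right summable_on_power_abs_int) auto
  note F = int_series_integral[OF f_cont f_bound f_sum]
  have h_cont: "continuous_on UNIV (h k)" for k
    unfolding h_def by (intro continuous_intros)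
  have h_bound: "norm (h k x) \<le> 1 / sqrt t * exp (- (pi / t) / 2) ^ nat \<bar>k\<bar>" if "\<bar>x\<bar> \<le> X" for k x and X :: real
    using exp_neg_square_le[of "pi / t" 0 0 k] t
    by (simp add: h_def a_def norm_mult norm_divide divide_right_mono)
  have h_sum: "(\<lambda>k::int. 1 / sqrt t * exp (- (pi / t) / 2) ^ nat \<bar>k\<bar>) summable_on UNIV"
    using t by (intro summable_on_cmult_right summable_on_power_abs_int) auto
  note Hs = int_series_integral[OF h_cont h_bound h_sum]
  define S where "S x = (\<Sum>\<^sub>\<infinity>n. f n x)" for x
  define T where "T x = (\<Sum>\<^sub>\<infinity>k. h k x)" for x
  have S_coeff: "integral {0..1} (\<lambda>x. S x * cis (2 * pi * of_int k * x)) = of_real (a k)" for k :: int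
  proof -
    define g where "g x = complex_of_real (exp (- (pi * t) * x\<^sup>2)) * cis (2 * pi * of_int k * x)" for x
    have g_shift: "f n x * cis (2 * pi * of_int k * x) = g (x + of_int n)" for n :: int and x
    proof -
      have "2 * pi * of_int k * (x + of_int n) = 2 * pi * of_int k * x + 2 * pi * of_int (k * n)"
        by (simp add: algebra_simps)
      then have "cis (2 * pi * of_int k * (x + of_int n)) = cis (2 * pi * of_int k * x)"
        by (simp only: cis_mult[symmetric] cis_multiple_2pi[OF Ints_of_int] mult_1_right)
      then show ?thesis by (simp add: f_def g_def)
    qed
    have g_int: "integrable lborel g"
      using gaussian_fourier_transform(1)[OF t, of "of_int k"] unfolding g_def .
    \<comment> \<open>The same partial sums have two limits: the coefficient of \<open>S\<close>, by
      exchange of sum and integral, and the integral of \<open>g\<close> over the line, by joining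
      the shifted unit intervals.\<close>
    have "(\<lambda>N. \<Sum>n\<in>{- int N..<int N}. integral {0..1} (\<lambda>x. f n x * cis (2 * pi * of_int k * x)))
        \<longlonglongrightarrow> integral {0..1} (\<lambda>x. S x * cis (2 * pi * of_int k * x))"
      unfolding S_def
      by (rule filterlim_compose[OF F(3)[unfolded has_sum_def] filterlim_symmetric_int_intervals])
    moreover have "continuous_on UNIV g" unfolding g_def by (intro continuous_intros)
    then have "(\<lambda>N. \<Sum>n\<in>{- int N..<int N}. integral {0..1} (\<lambda>x. f n x * cis (2 * pi * of_int k * x)))
        \<longlonglongrightarrow> (LINT x|lborel. g x)"
      using integral_symmetric_intervals_tendsto[OF g_int] by (simp add: integral_symmetric_interval_sum g_shift)
    ultimately have "integral {0..1} (\<lambda>x. S x * cis (2 * pi * of_int k * x)) = (LINT x|lborel. g x)"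
      by (rule LIMSEQ_unique)
    then show ?thesis
      using gaussian_fourier_transform(2)[OF t, of "of_int k"] by (simp add: g_def a_def)
  qed
  have T_coeff: "integral {0..1} (\<lambda>x. T x * cis (2 * pi * of_int k * x)) = of_real (a k)" for k :: int
  proof -
    \<comment> \<open>The frequency paired with \<open>k\<close> is \<open>- k\<close>; the value is
      still \<open>a k\<close> because \<open>a\<close> is even.\<close>
    have "integral {0..1} (\<lambda>x. h m x * cis (2 * pi * of_int k * x)) = (if m = - k then of_real (a k) else 0)" for m
    proof -
      have "h m x * cis (2 * pi * of_int k * x) = of_real (a m) * cis (2 * pi * of_int (m + k) * x)" for x
        by (simp add: h_def cis_mult algebra_simps)
      then show ?thesis
        using integral_cis_orthogonal[of "m + k"] by (auto simp: a_def)
    qed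
    moreover have "((\<lambda>m. if m = - k then of_real (a k) else 0) has_sum of_real (a k)) (UNIV :: int set)"
      by (rule has_sum_finite_neutralI[of "{- k}"]) auto
    ultimately show ?thesis using Hs(3)[where c = "2 * pi * of_int k"] has_sum_unique unfolding T_def by fastforce
  qed
  have "S x - T x = 0"
  proof (rule eq_0_if_orthogonal)
    show "continuous_on UNIV (\<lambda>x. S x - T x)"
      unfolding S_def T_def by (intro continuous_on_diff F(2) Hs(2))
    show "S (x + 1) - T (x + 1) = S x - T x" for x
    proof -
      have "S (x + 1) = (\<Sum>\<^sub>\<infinity>n. f (n + 1) x)"
        unfolding S_def f_def by (simp add: algebra_simps)
      also have "\<dots> = S x"
        unfolding S_def using infsum_reindex_bij_betw[OF bij_plus_right[of 1], of "\<lambda>n. f n x"] by simp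
      finally have "S (x + 1) = S x" .
      moreover have "h k (x + 1) = h k x" for k
      proof -
        have "2 * pi * of_int k * (x + 1) = 2 * pi * of_int k * x + 2 * pi * of_int k"
          by (simp add: algebra_simps)
        then have "cis (2 * pi * of_int k * (x + 1)) = cis (2 * pi * of_int k * x)"
          by (simp only: cis_mult[symmetric] cis_multiple_2pi[OF Ints_of_int] mult_1_right)
        then show ?thesis by (simp add: h_def)
      qed
      ultimately show ?thesis by (simp add: T_def)
    qed
    show "integral {0..1} (\<lambda>x. (S x - T x) * cis (2 * pi * of_int k * x)) = 0" for k :: int
    proof -
      have "((\<lambda>x. S x * cis (2 * pi * of_int k * x) - T x * cis (2 * pi * of_int k * x)) has_integral
          of_real (a k) - of_real (a k)) {0..1}"
        unfolding S_coeff[of k, symmetric]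
        by (subst (2) S_coeff, subst T_coeff[symmetric], unfold S_def T_def,
            intro has_integral_diff integrable_integral integrable_continuous_real continuous_intros
            continuous_on_subset[OF F(2)] continuous_on_subset[OF Hs(2)]) auto
      then show ?thesis by (simp add: left_diff_distrib integral_unique)
    qed
  qed
  then have "S x = T x" by simp
  then show ?thesis using that[of "S x"] F(1)[where x = x] Hs(1)[where x = x]
    by (simp add: S_def T_def f_def h_def a_def)
qed

section \<open>The inversion formula for the eta function\<close>

text \<open>Dedekind's eta function; writing q^(1/24) as an exponential in z avoids a choice of
  root.\<close>

definition eta :: "complex \<Rightarrow> complex" where
  "eta z = exp (of_real pi * \<i> * z / 12) * phi_prod (exp (2 * of_real pi * \<i> * z))"

lemma has_sum_even_odd:
  fixes f :: "int \<Rightarrow> 'a :: topological_comm_monoid_add"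
  assumes "((\<lambda>n. f (2 * n)) has_sum a) UNIV" "((\<lambda>n. f (2 * n + 1)) has_sum b) UNIV"
  shows "(f has_sum (a + b)) UNIV"
proof -
  have "(f has_sum a) (range (\<lambda>n. 2 * n))" "(f has_sum b) (range (\<lambda>n. 2 * n + 1))"
    using assms by (simp_all add: has_sum_reindex o_def inj_on_def)
  moreover have "range (\<lambda>n::int. 2 * n) \<inter> range (\<lambda>n. 2 * n + 1) = {}"
    by auto presburger
  ultimately have "(f has_sum (a + b)) (range (\<lambda>n. 2 * n) \<union> range (\<lambda>n. 2 * n + 1))"
    by (rule has_sum_Un_disjoint)
  moreover have "range (\<lambda>n::int. 2 * n) \<union> range (\<lambda>n. 2 * n + 1) = UNIV"
    by (auto simp: image_iff) presburger
  ultimately show ?thesis by simp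
qed

lemma has_sum_mod_3:
  fixes f :: "int \<Rightarrow> 'a :: topological_comm_monoid_add"
  assumes "((\<lambda>n. f (3 * n - 1)) has_sum a) UNIV" "((\<lambda>n. f (3 * n)) has_sum b) UNIV"
    "((\<lambda>n. f (3 * n + 1)) has_sum c) UNIV"
  shows "(f has_sum (a + b + c)) UNIV"
proof -
  have "(f has_sum a) (range (\<lambda>n. 3 * n - 1))" "(f has_sum b) (range (\<lambda>n. 3 * n))"
    "(f has_sum c) (range (\<lambda>n. 3 * n + 1))"
    using assms by (simp_all add: has_sum_reindex o_def inj_on_def)
  moreover have "range (\<lambda>n::int. 3 * n - 1) \<inter> range (\<lambda>n. 3 * n) = {}"
    by auto presburger
  moreover have "(range (\<lambda>n::int. 3 * n - 1) \<union> range (\<lambda>n. 3 * n)) \<inter> range (\<lambda>n. 3 * n + 1) = {}"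
    by auto presburger+
  ultimately have "(f has_sum (a + b + c))
      ((range (\<lambda>n. 3 * n - 1) \<union> range (\<lambda>n. 3 * n)) \<union> range (\<lambda>n. 3 * n + 1))"
    by (intro has_sum_Un_disjoint)
  moreover have "(range (\<lambda>n. 3 * n - 1) \<union> range (\<lambda>n::int. 3 * n)) \<union> range (\<lambda>n. 3 * n + 1) = UNIV"
    by (auto simp: image_iff) presburger
  ultimately show ?thesis by simp
qed

lemma cis_int_pi: "cis (pi * of_int n) = (-1) powi n"
  using cis_power_int[of pi n] by (simp add: mult.commute)

text \<open>Completing the square in the pentagonal exponent absorbs the factor q^(1/24) and leaves
  an alternating Gaussian sum.\<close>

lemma eta_imaginary_has_sum:
  fixes y :: real
  assumes y: "y > 0"
  shows "((\<lambda>n::int. (-1) powi n * of_real (exp (- (3 * pi * y) * (of_int n - 1/6)\<^sup>2)))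
           has_sum eta (\<i> * of_real y)) UNIV"
proof -
  define q where "q = exp (2 * of_real pi * \<i> * (\<i> * of_real y))"
  have q: "q = exp (of_real (- (2 * pi * y)))"
    unfolding q_def by (simp add: algebra_simps)
  have "norm q < 1" using y by (simp add: q)
  from has_sum_cmult_right[OF phi_prod_has_sum[OF this], of "exp (of_real pi * \<i> * (\<i> * of_real y) / 12)"]
  have "((\<lambda>n::int. exp (of_real pi * \<i> * (\<i> * of_real y) / 12) *
        ((-1) powi n * q powi (n * (3 * n - 1) div 2))) has_sum eta (\<i> * of_real y)) UNIV"
    by (simp add: eta_def q_def)
  moreover have "exp (of_real pi * \<i> * (\<i> * of_real y) / 12) * ((-1) powi n * q powi (n * (3 * n - 1) div 2)) =
      (-1) powi n * of_real (exp (- (3 * pi * y) * (of_int n - 1/6)\<^sup>2))" for n :: int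
  proof -
    define m where "m = n * (3 * n - 1) div 2"
    have "even (n * (3 * n - 1))" by auto
    then have "2 * m = n * (3 * n - 1)" unfolding m_def by simp
    then have "2 * real_of_int m = of_int n * (3 * of_int n - 1)"
      by (metis of_int_1 of_int_diff of_int_mult of_int_numeral)
    then have m: "real_of_int m = of_int n * (3 * of_int n - 1) / 2" by simp
    have "exp (of_real pi * \<i> * (\<i> * of_real y) / 12) * q powi m =
        exp (of_real (- (pi * y / 12))) * exp (of_int m * of_real (- (2 * pi * y)))"
      unfolding q exp_power_int by (simp add: algebra_simps)
    also have "\<dots> = of_real (exp (- (pi * y / 12) + of_int m * (- (2 * pi * y))))"
      unfolding exp_add by (simp flip: exp_of_real)
    also have "- (pi * y / 12) + of_int m * (- (2 * pi * y)) = - (3 * pi * y) * (of_int n - 1/6)\<^sup>2"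
      unfolding m by (simp add: power2_eq_square field_simps)
    finally show ?thesis unfolding m_def by (simp add: mult_ac)
  qed
  ultimately show ?thesis by simp
qed

text \<open>The map n -> -n - 1 permutes the integers, so the sum equals its own negative.\<close>

lemma has_sum_antisymmetric_eq_0:
  fixes v :: "int \<Rightarrow> complex"
  assumes "v summable_on UNIV" "\<And>n. v (- n - 1) = - v n"
  shows "(v has_sum 0) UNIV"
proof -
  obtain V where V: "(v has_sum V) UNIV" using assms(1) by (auto simp: summable_on_def)
  have "bij_betw (\<lambda>n::int. - n - 1) UNIV UNIV"
    by (rule bij_betwI[of _ _ _ "\<lambda>n. - n - 1"]) auto
  then have "((\<lambda>n. v (- n - 1)) has_sum V) UNIV"
    using has_sum_reindex_bij_betw[of _ UNIV UNIV v V] V by blast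
  moreover have "((\<lambda>n. v (- n - 1)) has_sum - V) UNIV"
    using V by (simp add: assms(2) has_sum_uminus)
  ultimately have "V = - V" using has_sum_unique by blast
  then show ?thesis using V by simp
qed

text \<open>Since \<open>n(3n - 1)/2 + 1/24 = (3/2)(n - 1/6)^2\<close>, the even and the odd \<open>n\<close> give two shifted
  Gaussian sums. After Poisson summation the frequencies \<open>k\<close> that are even or divisible by 3
  cancel, and \<open>k = 6n - 1\<close>, \<open>k = 6n + 1\<close> both reproduce the series of \<open>\<eta>\<close>.\<close>

lemma eta_inversion_imaginary:
  fixes y :: real
  assumes y: "y > 0"
  shows "eta (\<i> * of_real (1 / y)) = of_real (sqrt y) * eta (\<i> * of_real y)"
proof -
  \<comment> \<open>Replacing n by 2n or 2n + 1 turns 3y (n - 1/6)^2 into 12y (n - 1/12)^2 or 12y (n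
    + 5/12)^2; this fixes the parameter and the two shifts.\<close>
  have t: "12 * y > 0" using y by simp
  define A where "A k = exp (- (pi / (12 * y)) * (of_int k)\<^sup>2) / sqrt (12 * y)" for k :: int
  obtain G1 where G1:
    "((\<lambda>n::int. complex_of_real (exp (- (pi * (12 * y)) * (- 1/12 + of_int n)\<^sup>2))) has_sum G1) UNIV"
    "((\<lambda>k::int. of_real (A k) * cis (2 * pi * of_int k * (- 1/12))) has_sum G1) UNIV"
    using poisson_gaussian[OF t, of "- 1/12"] unfolding A_def by blast
  obtain G2 where G2:
    "((\<lambda>n::int. complex_of_real (exp (- (pi * (12 * y)) * (5/12 + of_int n)\<^sup>2))) has_sum G2) UNIV"
    "((\<lambda>k::int. of_real (A k) * cis (2 * pi * of_int k * (5/12))) has_sum G2) UNIV"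
    using poisson_gaussian[OF t, of "5/12"] unfolding A_def by blast
  define f where "f n = (-1) powi n * complex_of_real (exp (- (3 * pi * y) * (of_int n - 1/6)\<^sup>2))" for n :: int
  have "f (2 * n) = of_real (exp (- (pi * (12 * y)) * (- 1/12 + of_int n)\<^sup>2))" for n
  proof -
    have "- (3 * pi * y) * (of_int (2 * n) - 1/6)\<^sup>2 = - (pi * (12 * y)) * (- 1/12 + of_int n)\<^sup>2"
      by (simp add: power2_eq_square field_simps)
    then show ?thesis unfolding f_def by (simp only:) simp
  qed
  moreover have "f (2 * n + 1) = - of_real (exp (- (pi * (12 * y)) * (5/12 + of_int n)\<^sup>2))" for n
  proof -
    have "- (3 * pi * y) * (of_int (2 * n + 1) - 1/6)\<^sup>2 = - (pi * (12 * y)) * (5/12 + of_int n)\<^sup>2"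
      by (simp add: power2_eq_square field_simps)
    then show ?thesis unfolding f_def by (simp only:) simp
  qed
  ultimately have "(f has_sum (G1 + - G2)) UNIV"
    by (intro has_sum_even_odd) (simp_all only: has_sum_uminus minus_minus G1(1) G2(1))
  then have eta1: "eta (\<i> * of_real y) = G1 - G2"
    using eta_imaginary_has_sum[OF y] has_sum_unique unfolding f_def by fastforce
  define h where "h k = of_real (A k) * (cis (2 * pi * of_int k * (- 1/12)) - cis (2 * pi * of_int k * (5/12)))" for k :: int
  have h: "(h has_sum (G1 - G2)) UNIV"
  proof -
    have "((\<lambda>k. of_real (A k) * cis (2 * pi * of_int k * (- 1/12)) + - (of_real (A k) * cis (2 * pi * of_int k * (5/12))))
        has_sum (G1 + - G2)) UNIV"
      by (intro has_sum_add G1(2)) (simp only: has_sum_uminus minus_minus G2(2))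
    then show ?thesis by (simp add: h_def[abs_def] right_diff_distrib)
  qed
  \<comment> \<open>The shifts differ by 1/2, so the phases differ by (-1)^k: even frequencies
    cancel, odd ones double.\<close>
  have c: "cis (2 * pi * of_int k * (5/12)) = (-1) powi k * cis (2 * pi * of_int k * (- 1/12))" for k
    unfolding cis_int_pi[symmetric] cis_mult by (simp add: field_simps)
  have h_even: "h (2 * j) = 0" for j unfolding h_def c by simp
  have h_odd: "h (2 * j + 1) = 2 * of_real (A (2 * j + 1)) * cis (- (pi * of_int (2 * j + 1) / 6))" for j
  proof -
    have "2 * pi * of_int (2 * j + 1) * (- 1/12) = - (pi * of_int (2 * j + 1) / 6)" by (simp add: field_simps)
    then show ?thesis unfolding h_def c by (simp only:) simp
  qed
  define u where "u n = (-1) powi n * complex_of_real (exp (- (3 * pi * (1 / y)) * (of_int n - 1/6)\<^sup>2))" for n :: int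
  define B where "B = 2 / complex_of_real (sqrt (12 * y))"
  have u: "(u has_sum eta (\<i> * of_real (1 / y))) UNIV"
    unfolding u_def using y by (intro eta_imaginary_has_sum) auto
  \<comment> \<open>Frequency k = 6n - 1, where k^2/12 = 3 (n - 1/6)^2 returns the exponent of the
    eta series at 1/y.\<close>
  have hm: "h (2 * (3 * n - 1) + 1) = B * cis (pi / 6) * u n" for n
  proof -
    have "- (pi / (12 * y)) * (of_int (2 * (3 * n - 1) + 1))\<^sup>2 = - (3 * pi * (1 / y)) * (of_int n - 1/6)\<^sup>2"
      using y by (simp add: power2_eq_square field_simps)
    then have A: "A (2 * (3 * n - 1) + 1) = exp (- (3 * pi * (1 / y)) * (of_int n - 1/6)\<^sup>2) / sqrt (12 * y)"
      unfolding A_def by (simp only:)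
    have "- (pi * of_int (2 * (3 * n - 1) + 1) / 6) = pi * of_int (- n) + pi / 6"
      by (simp add: field_simps)
    then have "cis (- (pi * of_int (2 * (3 * n - 1) + 1) / 6)) = (-1) powi n * cis (pi / 6)"
      by (simp only: cis_mult[symmetric] cis_int_pi power_int_minus_one_minus)
    then show ?thesis unfolding h_odd A u_def B_def by simp
  qed
  \<comment> \<open>Frequency 6n + 1 = -(6(-n) - 1), hence the same series read at
    \<open>- n\<close>, with the conjugate constant phase.\<close>
  have hp: "h (2 * (3 * n) + 1) = B * cis (- pi / 6) * u (- n)" for n
  proof -
    have "- (pi / (12 * y)) * (of_int (2 * (3 * n) + 1))\<^sup>2 = - (3 * pi * (1 / y)) * (of_int (- n) - 1/6)\<^sup>2"
      using y by (simp add: power2_eq_square field_simps)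
    then have A: "A (2 * (3 * n) + 1) = exp (- (3 * pi * (1 / y)) * (of_int (- n) - 1/6)\<^sup>2) / sqrt (12 * y)"
      unfolding A_def by (simp only:)
    have "- (pi * of_int (2 * (3 * n) + 1) / 6) = pi * of_int (- n) + (- pi / 6)"
      by (simp add: field_simps)
    then have "cis (- (pi * of_int (2 * (3 * n) + 1) / 6)) = (-1) powi (- n) * cis (- pi / 6)"
      by (simp only: cis_mult[symmetric] cis_int_pi)
    then show ?thesis unfolding h_odd A u_def B_def by simp
  qed
  \<comment> \<open>Frequencies k = 6n + 3: the reflection n -> -n - 1 sends k to -k, and the two
    phases are opposite because k/3 is odd.\<close>
  have "inj (\<lambda>n::int. 2 * (3 * n + 1) + 1)" by (auto simp: inj_on_def)
  then have "(\<lambda>n. h (2 * (3 * n + 1) + 1)) summable_on UNIV"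
    using summable_on_subset_banach[OF has_sum_imp_summable[OF h], of "range (\<lambda>n. 2 * (3 * n + 1) + 1)"]
    by (simp add: summable_on_reindex o_def)
  moreover have "h (2 * (3 * (- n - 1) + 1) + 1) = - h (2 * (3 * n + 1) + 1)" for n
  proof -
    have "A (2 * (3 * (- n - 1) + 1) + 1) = A (2 * (3 * n + 1) + 1)"
      unfolding A_def by (simp add: power2_eq_square algebra_simps)
    moreover have "- (pi * of_int (2 * (3 * (- n - 1) + 1) + 1) / 6) =
        - (pi * of_int (2 * (3 * n + 1) + 1) / 6) + pi * of_int (2 * n + 1)"
      by (simp add: field_simps)
    then have "cis (- (pi * of_int (2 * (3 * (- n - 1) + 1) + 1) / 6)) =
        - cis (- (pi * of_int (2 * (3 * n + 1) + 1) / 6))"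
      by (simp only: cis_mult[symmetric] cis_int_pi) simp
    ultimately show ?thesis unfolding h_odd by simp
  qed
  ultimately have h0: "((\<lambda>n. h (2 * (3 * n + 1) + 1)) has_sum 0) UNIV"
    by (rule has_sum_antisymmetric_eq_0)
  have "((\<lambda>n. u (- n)) has_sum eta (\<i> * of_real (1 / y))) UNIV"
    using u has_sum_reindex_bij_betw[OF bij_uminus, of u] by simp
  then have "((\<lambda>j. h (2 * j + 1)) has_sum
      (B * cis (pi / 6) * eta (\<i> * of_real (1 / y)) + B * cis (- pi / 6) * eta (\<i> * of_real (1 / y)) + 0)) UNIV"
    unfolding hm[symmetric]
    by (intro has_sum_mod_3 h0; simp only: hm hp) (intro has_sum_cmult_right u; assumption)+
  then have "(h has_sum (0 + (B * cis (pi / 6) * eta (\<i> * of_real (1 / y)) +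
      B * cis (- pi / 6) * eta (\<i> * of_real (1 / y)) + 0))) UNIV"
    by (rule has_sum_even_odd[of h 0, rotated]) (simp add: h_even)
  then have "G1 - G2 = B * (cis (pi / 6) + cis (- pi / 6)) * eta (\<i> * of_real (1 / y))"
    using has_sum_unique[OF h] by (simp add: algebra_simps)
  also have "cis (pi / 6) + cis (- pi / 6) = of_real (sqrt 3)"
    by (simp add: complex_eq_iff cos_30 sin_30)
  also have "B * of_real (sqrt 3) = 1 / of_real (sqrt y)"
  proof -
    have "sqrt (12 * y) = 2 * (sqrt 3 * sqrt y)"
      using real_sqrt_mult[of 4 "3 * y"] by (simp add: real_sqrt_mult)
    then show ?thesis unfolding B_def using y by simp
  qed
  finally show ?thesis unfolding eta1 using y by simp
qed

section \<open>Eta as a holomorphic function on the upper half plane\<close>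

lemma norm_exp_2pi_i: "norm (exp (2 * of_real pi * \<i> * z)) = exp (- (2 * pi * Im z))"
  by (simp add: norm_exp_eq_Re)

lemma norm_exp_2pi_i_less_1: "Im z > 0 \<Longrightarrow> norm (exp (2 * of_real pi * \<i> * z)) < 1"
  by (simp add: norm_exp_2pi_i)

lemma eta_nonzero: "Im z > 0 \<Longrightarrow> eta z \<noteq> 0"
  by (simp add: eta_def phi_prod_nonzero norm_exp_2pi_i_less_1)

lemma eta_holomorphic: "eta holomorphic_on {z. Im z > 0}"
proof -
  have "phi_prod \<circ> (\<lambda>z. exp (2 * of_real pi * \<i> * z)) holomorphic_on {z. Im z > 0}"
    by (rule holomorphic_on_compose_gen[OF _ phi_prod_holomorphic])
       (auto intro!: holomorphic_intros norm_exp_2pi_i_less_1)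
  then show ?thesis unfolding eta_def [abs_def] by (auto simp: o_def intro!: holomorphic_intros)
qed

lemma eta_plus_1: "eta (z + 1) = cis (pi / 12) * eta z"
proof -
  have "exp (2 * of_real pi * \<i> * (z + 1)) = exp (2 * of_real pi * \<i> * z)"
    by (simp add: distrib_left exp_add)
  moreover have "exp (of_real pi * \<i> * (z + 1) / 12) = cis (pi / 12) * exp (of_real pi * \<i> * z / 12)"
    unfolding cis_conv_exp exp_add[symmetric] by (simp add: field_simps)
  ultimately show ?thesis by (simp add: eta_def)
qed

lemma Im_one_divide_neg: "Im z > 0 \<Longrightarrow> Im (1 / z) < 0"
  by (auto simp: Im_divide intro!: divide_pos_pos sum_power2_gt_zero_iff[THEN iffD2])

text \<open>Analytic continuation from the imaginary axis. For Im z > 0 the number -iz has positive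
  real part, so \<open>csqrt\<close> stays off its cut and both sides are holomorphic.\<close>

lemma eta_inversion:
  assumes "Im z > 0"
  shows "eta (- 1 / z) = csqrt (- \<i> * z) * eta z"
proof -
  define H where "H = {z. Im z > 0}"
  define f where "f z = eta (- 1 / z) - csqrt (- \<i> * z) * eta z" for z
  have H: "open H" "connected H"
    unfolding H_def by (auto intro: open_halfspace_Im_gt convex_connected convex_halfspace_Im_gt)
  have "eta \<circ> (\<lambda>z. - 1 / z) holomorphic_on H"
    unfolding H_def
    by (rule holomorphic_on_compose_gen[OF _ eta_holomorphic])
       (auto intro!: holomorphic_intros Im_one_divide_neg)
  then have "(\<lambda>z. eta (- 1 / z)) holomorphic_on H" by (simp add: o_def)
  then have hol: "f holomorphic_on H"
    using eta_holomorphic unfolding f_def H_def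
    by (intro holomorphic_intros) (auto simp: complex_nonpos_Reals_iff)
  define U where "U = (\<lambda>y. \<i> * complex_of_real y) ` {0<..}"
  have "f z = 0" if zU: "z \<in> U" for z
  proof -
    obtain y where y: "z = \<i> * of_real y" "y > 0" using zU unfolding U_def by blast
    have "- 1 / z = \<i> * of_real (1 / y)" using y by (simp add: field_simps)
    moreover have "- \<i> * z = of_real y" using y by simp
    ultimately show ?thesis
      unfolding f_def y(1) using eta_inversion_imaginary[OF y(2)] y by (simp add: csqrt_of_real_nonneg)
  qed
  moreover have "\<i> islimpt U"
    unfolding islimpt_approachable
  proof (intro allI impI)
    fix e :: real assume "e > 0"
    then have "\<i> * of_real (1 + e / 2) \<in> U" "\<i> * of_real (1 + e / 2) \<noteq> \<i>"
        "dist (\<i> * of_real (1 + e / 2)) \<i> < e"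
      by (auto simp: U_def dist_norm algebra_simps norm_mult complex_eq_iff)
    then show "\<exists>x'\<in>U. x' \<noteq> \<i> \<and> dist x' \<i> < e" by blast
  qed
  moreover have "U \<subseteq> H" by (auto simp: U_def H_def)
  moreover have "\<i> \<in> H" "z \<in> H" using assms by (auto simp: H_def)
  ultimately have "f z = 0"
    using analytic_continuation[OF hol H] by blast
  then show ?thesis by (simp add: f_def)
qed

section \<open>The modular equation of level 21\<close>

text \<open>\<open>eta_pair\<close> and \<open>eta_ratio\<close> are level 3 building blocks:
  functions of level 21 are formed from their values at z and 7z, so the transformation rules are
  only needed at level 3.\<close>

definition eta_pair :: "complex \<Rightarrow> complex" where
  "eta_pair z = eta z * eta (3 * z)"

definition eta_ratio :: "complex \<Rightarrow> complex" where
  "eta_ratio z = (eta z / eta (3 * z)) ^ 2"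

text \<open>With x and y the quotients of \<open>eta_pair\<close> and of \<open>eta_ratio\<close> at
  z and 7z, this is x + 7/x - y - 1/y + 3; x is X of the overview and y is w_1^2.\<close>

definition level21 :: "complex \<Rightarrow> complex" where
  "level21 z = eta_pair z / eta_pair (7 * z) + 7 * (eta_pair (7 * z) / eta_pair z)
     - eta_ratio z / eta_ratio (7 * z) - eta_ratio (7 * z) / eta_ratio z + 3"

section \<open>Transformation rules at level 3\<close>

lemma Im_neg_one_divide_pos: "Im z > 0 \<Longrightarrow> Im (- 1 / (3 * z)) > 0"
  using Im_one_divide_neg[of "3 * z"] by simp

lemma eta_ratio_nonzero: "Im z > 0 \<Longrightarrow> eta_ratio z \<noteq> 0"
  by (simp add: eta_ratio_def eta_nonzero)

lemma eta_plus_nat: "eta (z + of_nat n) = cis (pi / 12) ^ n * eta z"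
proof (induction n)
  case (Suc n)
  then show ?case using eta_plus_1[of "z + of_nat n"] by (simp add: add_ac)
qed simp

lemma eta_3_plus_1: "eta (3 * (z + 1)) = cis (pi / 12) ^ 3 * eta (3 * z)"
  using eta_plus_nat[of "3 * z" 3] by (simp add: algebra_simps)

lemma cis_power_eq: "real n * a = b \<Longrightarrow> cis a ^ n = cis b"
  using Complex.DeMoivre by simp

lemma eta_pair_plus_1: "eta_pair (z + 1) = cis (pi / 3) * eta_pair z"
proof -
  have "cis (pi / 12) ^ 4 = cis (pi / 3)" by (rule cis_power_eq) simp
  then show ?thesis
    unfolding eta_pair_def eta_3_plus_1 eta_plus_1 by (simp add: eval_nat_numeral mult_ac)
qed

lemma eta_ratio_plus_1: "eta_ratio (z + 1) = eta_ratio z / cis (pi / 3)"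
proof -
  have "cis (pi / 12) ^ 4 = cis (pi / 3)" by (rule cis_power_eq) simp
  moreover have "eta_ratio (z + 1) = eta_ratio z / cis (pi / 12) ^ 4"
    unfolding eta_ratio_def eta_3_plus_1 eta_plus_1 by (simp add: field_simps eval_nat_numeral)
  ultimately show ?thesis by simp
qed

lemma csqrt_3_mult:
  assumes "Re z > 0"
  shows "csqrt (3 * z) = of_real (sqrt 3) * csqrt z"
proof (rule csqrt_unique)
  show "(of_real (sqrt 3) * csqrt z) ^ 2 = 3 * z"
    by (simp add: power_mult_distrib flip: of_real_power)
  have "Re (csqrt z) > 0"
    using assms norm_ge_zero[of z] by (simp add: add_nonneg_pos)
  then show "0 < Re (of_real (sqrt 3) * csqrt z) \<or>
      Re (of_real (sqrt 3) * csqrt z) = 0 \<and> 0 \<le> Im (of_real (sqrt 3) * csqrt z)" by simp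
qed

text \<open>The map exchanges eta(z) and eta(3z) up to factors with the same \<open>csqrt\<close>.
  In the product these square to -iz, in the quotient they cancel, so no branch of a root
  survives.\<close>

lemma
  assumes "Im z > 0"
  shows eta_pair_fricke: "eta_pair (- 1 / (3 * z)) = of_real (sqrt 3) * (- \<i> * z) * eta_pair z"
    and eta_ratio_fricke: "eta_ratio (- 1 / (3 * z)) = 3 / eta_ratio z"
proof -
  have 1: "eta (- 1 / (3 * z)) = of_real (sqrt 3) * csqrt (- \<i> * z) * eta (3 * z)"
    using eta_inversion[of "3 * z"] csqrt_3_mult[of "- \<i> * z"] assms by (simp add: mult_ac)
  have 2: "eta (3 * (- 1 / (3 * z))) = csqrt (- \<i> * z) * eta z"
    using eta_inversion[of z] assms by simp
  have sq: "csqrt (- \<i> * z) * csqrt (- \<i> * z) = - \<i> * z"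
    using power2_csqrt[of "- \<i> * z"] by (simp add: power2_eq_square)
  show "eta_pair (- 1 / (3 * z)) = of_real (sqrt 3) * (- \<i> * z) * eta_pair z"
  proof -
    have "eta_pair (- 1 / (3 * z)) =
        of_real (sqrt 3) * (csqrt (- \<i> * z) * csqrt (- \<i> * z)) * (eta z * eta (3 * z))"
      unfolding eta_pair_def 1 2 by (simp only: mult_ac)
    then show ?thesis unfolding sq eta_pair_def .
  qed
  have "csqrt (- \<i> * z) \<noteq> 0" using assms by auto
  then show "eta_ratio (- 1 / (3 * z)) = 3 / eta_ratio z"
    unfolding eta_ratio_def 1 2 
    by (simp add: power_divide power_mult_distrib flip: of_real_power)
qed

text \<open>\<open>u/(3u + 1)\<close> is \<open>W T^(-1) W u\<close> for \<open>W u = -1/(3u)\<close> and \<open>T u = u + 1\<close>. Likewise all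
  transformations of level 21 below become words in \<open>W\<close> and \<open>T\<close> when applied to \<open>z\<close> or \<open>7z\<close>.\<close>

lemma
  assumes u: "Im u > 0"
  shows Im_level3_pos: "Im (u / (3 * u + 1)) > 0"
    and eta_pair_level3: "eta_pair (u / (3 * u + 1)) = (3 * u + 1) * eta_pair u / cis (pi / 3)"
    and eta_ratio_level3: "eta_ratio (u / (3 * u + 1)) = eta_ratio u / cis (pi / 3)"
proof -
  \<comment> \<open>\<open>b\<close> is the image of \<open>u\<close> under T^(-1) W; a final W
    leads to u/(3u + 1).\<close>
  define b where "b = - 1 / (3 * u) - 1"
  have b: "Im b > 0" using Im_neg_one_divide_pos[OF u] by (simp add: b_def)
  have nz: "u \<noteq> 0" "b \<noteq> 0" "3 * u + 1 \<noteq> 0" using u b by (auto simp: complex_eq_iff)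
  have bu: "b * u = - (3 * u + 1) / 3" using nz by (simp add: b_def field_simps)
  have eq: "u / (3 * u + 1) = - 1 / (3 * b)"
    using nz bu by (simp add: field_simps)
  show "Im (u / (3 * u + 1)) > 0" unfolding eq by (rule Im_neg_one_divide_pos[OF b])
  have pb: "eta_pair b = of_real (sqrt 3) * (- \<i> * u) * eta_pair u / cis (pi / 3)"
    using eta_pair_plus_1[of b] eta_pair_fricke[OF u] by (simp add: b_def field_simps)
  have "eta_pair (u / (3 * u + 1)) = of_real (sqrt 3) * (- \<i> * b) * (of_real (sqrt 3) * (- \<i> * u) * eta_pair u / cis (pi / 3))"
    unfolding eq eta_pair_fricke[OF b] pb ..
  also have "\<dots> = (- (of_real (sqrt 3) * of_real (sqrt 3)) * (b * u)) * eta_pair u / cis (pi / 3)"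
    by (simp add: field_simps)
  also have "of_real (sqrt 3) * of_real (sqrt 3) = (3 :: complex)"
    by (simp flip: of_real_mult)
  also have "- 3 * (b * u) = 3 * u + 1" unfolding bu by simp
  finally show "eta_pair (u / (3 * u + 1)) = (3 * u + 1) * eta_pair u / cis (pi / 3)" .
  have rb: "eta_ratio b = 3 * cis (pi / 3) / eta_ratio u"
    using eta_ratio_plus_1[of b] eta_ratio_fricke[OF u] by (simp add: b_def field_simps)
  show "eta_ratio (u / (3 * u + 1)) = eta_ratio u / cis (pi / 3)"
    unfolding eq eta_ratio_fricke[OF b] rb by simp
qed

lemma cis_pi_3_power_3: "cis (pi / 3) ^ 3 = -1" "cis (pi / 3) ^ 6 = 1"
  by (simp_all add: Complex.DeMoivre)

lemma eta_pair_plus_nat: "eta_pair (z + of_nat n) = cis (pi / 3) ^ n * eta_pair z"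
proof (induction n)
  case (Suc n)
  then show ?case using eta_pair_plus_1[of "z + of_nat n"] by (simp add: add_ac)
qed simp

lemma eta_ratio_plus_nat: "eta_ratio (z + of_nat n) = eta_ratio z / cis (pi / 3) ^ n"
proof (induction n)
  case (Suc n)
  then show ?case using eta_ratio_plus_1[of "z + of_nat n"] by (simp add: add_ac)
qed simp

section \<open>Invariance at level 21\<close>

lemma seven_cancel: "7 * (x / (7 * y)) = x / (y :: complex)"
  by simp

text \<open>The expression x + 7/x - y - 1/y + 3 is symmetric under x -> 7/x and under y -> 1/y, so
  a transformation may act on each quotient by either the identity or the inversion.\<close>

lemma level21_cong:
  assumes "eta_pair z' / eta_pair (7 * z') = eta_pair z / eta_pair (7 * z) \<or>
           eta_pair z' / eta_pair (7 * z') = 7 * (eta_pair (7 * z) / eta_pair z)"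
    and "eta_ratio z' / eta_ratio (7 * z') = eta_ratio z / eta_ratio (7 * z) \<or>
         eta_ratio z' / eta_ratio (7 * z') = eta_ratio (7 * z) / eta_ratio z"
  shows "level21 z' = level21 z"
proof -
  have level21_alt: "level21 z = (let x = eta_pair z / eta_pair (7 * z); y = eta_ratio z / eta_ratio (7 * z)
      in x + 7 / x - y - 1 / y + 3)" for z
    by (simp add: level21_def Let_def)
  show ?thesis
    using assms unfolding level21_alt Let_def by (elim disjE) simp_all
qed

text \<open>Shifting z by 1 shifts 7z by 7, and the multiplier is a sixth root of unity, so
  numerator and denominator acquire the same factor.\<close>

lemma level21_plus_1: "level21 (z + 1) = level21 z"
proof -
  have "7 * (z + 1) = 7 * z + of_nat 7" by (simp add: algebra_simps)
  moreover have "cis (pi / 3) ^ 7 = cis (pi / 3)" using cis_pi_3_power_3(2) by (simp add: eval_nat_numeral)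
  ultimately show ?thesis
    by (intro level21_cong disjI1; simp only: eta_pair_plus_nat eta_ratio_plus_nat eta_pair_plus_1 eta_ratio_plus_1) simp_all
qed

lemma level21_plus_int: "level21 (z + of_int n) = level21 z"
proof (induction n rule: int_induct[of _ 0])
  case (step1 i)
  then show ?case using level21_plus_1[of "z + of_int i"] by (simp add: add_ac)
next
  case (step2 i)
  then show ?case using level21_plus_1[of "z + of_int (i - 1)"] by (simp add: add_ac)
qed auto

text \<open>With W u = -1/(3u), the map sends z to W(7z) and 7z to W z. This inverts x up to the
  factor 7; y is fixed, since W also inverts each \<open>eta_ratio\<close>.\<close>

lemma level21_fricke:
  assumes z: "Im z > 0"
  shows "level21 (- 1 / (21 * z)) = level21 z"
proof (rule level21_cong)
  have e: "- 1 / (21 * z) = - 1 / (3 * (7 * z))" "7 * (- 1 / (21 * z)) = - 1 / (3 * z)" by simp_all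
  have z7: "Im (7 * z) > 0" using z by simp
  have nz: "z \<noteq> 0" using z by auto
  show "eta_pair (- 1 / (21 * z)) / eta_pair (7 * (- 1 / (21 * z))) = eta_pair z / eta_pair (7 * z) \<or>
      eta_pair (- 1 / (21 * z)) / eta_pair (7 * (- 1 / (21 * z))) = 7 * (eta_pair (7 * z) / eta_pair z)"
  proof (rule disjI2)
    have "of_real (sqrt 3) * (- \<i> * (7 * z)) = 7 * (of_real (sqrt 3) * (- \<i> * z))" by simp
    then show "eta_pair (- 1 / (21 * z)) / eta_pair (7 * (- 1 / (21 * z))) = 7 * (eta_pair (7 * z) / eta_pair z)"
      unfolding e(2) unfolding e(1) eta_pair_fricke[OF z] eta_pair_fricke[OF z7]
      using nz by (simp only:) simp
  qed
  show "eta_ratio (- 1 / (21 * z)) / eta_ratio (7 * (- 1 / (21 * z))) = eta_ratio z / eta_ratio (7 * z) \<or>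
      eta_ratio (- 1 / (21 * z)) / eta_ratio (7 * (- 1 / (21 * z))) = eta_ratio (7 * z) / eta_ratio z"
    unfolding e(2) unfolding e(1) eta_ratio_fricke[OF z] eta_ratio_fricke[OF z7]
    using eta_ratio_nonzero[OF z] eta_ratio_nonzero[OF z7] by simp
qed

text \<open>A map of determinant 7. With u = 7z + 2 it sends z to u/(3u + 1) and 7z to z/(3z + 1) +
  2, so the level 3 rules apply to both; x becomes 7/x and y becomes 1/y.\<close>

lemma level21_atkin_lehner_7:
  assumes z: "Im z > 0"
  shows "level21 ((7 * z + 2) / (21 * z + 7)) = level21 z"
proof (rule level21_cong)
  define u where "u = 7 * z + of_nat 2"
  have u: "Im u > 0" using z by (simp add: u_def)
  have nz: "3 * z + 1 \<noteq> 0" "3 * u + 1 \<noteq> 0" using z u by (auto simp: complex_eq_iff)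
  have e1: "(7 * z + 2) / (21 * z + 7) = u / (3 * u + 1)" by (simp add: u_def algebra_simps)
  have "21 * z + 7 = 7 * (3 * z + 1)" by (simp add: algebra_simps)
  then have "7 * ((7 * z + 2) / (21 * z + 7)) = (7 * z + 2) / (3 * z + 1)"
    by (simp only: seven_cancel)
  also have "\<dots> = z / (3 * z + 1) + of_nat 2" using nz by (simp add: field_simps)
  finally have e2: "7 * ((7 * z + 2) / (21 * z + 7)) = z / (3 * z + 1) + of_nat 2" .
  have pu: "eta_pair u = cis (pi / 3) ^ 2 * eta_pair (7 * z)" and ru: "eta_ratio u = eta_ratio (7 * z) / cis (pi / 3) ^ 2"
    unfolding u_def by (rule eta_pair_plus_nat, rule eta_ratio_plus_nat)
  have u7: "3 * u + 1 = 7 * (3 * z + 1)" by (simp add: u_def algebra_simps)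
  have E1: "eta_pair ((7 * z + 2) / (21 * z + 7)) = 7 * ((3 * z + 1) * cis (pi / 3) * eta_pair (7 * z))"
    unfolding e1 eta_pair_level3[OF u] unfolding pu u7 by (simp add: power2_eq_square)
  have E2: "eta_pair (7 * ((7 * z + 2) / (21 * z + 7))) = (3 * z + 1) * cis (pi / 3) * eta_pair z"
    unfolding e2 eta_pair_plus_nat eta_pair_level3[OF z] by (simp add: power2_eq_square)
  show "eta_pair ((7 * z + 2) / (21 * z + 7)) / eta_pair (7 * ((7 * z + 2) / (21 * z + 7))) = eta_pair z / eta_pair (7 * z) \<or>
      eta_pair ((7 * z + 2) / (21 * z + 7)) / eta_pair (7 * ((7 * z + 2) / (21 * z + 7))) = 7 * (eta_pair (7 * z) / eta_pair z)"
    unfolding E1 E2 using nz by simp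
  show "eta_ratio ((7 * z + 2) / (21 * z + 7)) / eta_ratio (7 * ((7 * z + 2) / (21 * z + 7))) = eta_ratio z / eta_ratio (7 * z) \<or>
      eta_ratio ((7 * z + 2) / (21 * z + 7)) / eta_ratio (7 * ((7 * z + 2) / (21 * z + 7))) = eta_ratio (7 * z) / eta_ratio z"
    unfolding e2 eta_ratio_plus_nat eta_ratio_level3[OF z] unfolding e1 eta_ratio_level3[OF u] ru
    by simp
qed

text \<open>One further application of W T^(-1) to u/(3u + 1).\<close>

lemma
  assumes u: "Im u > 0"
  shows eta_pair_level3': "eta_pair ((3 * u + 1) / (6 * u + 3)) =
      of_real (sqrt 3) * \<i> * (2 * u + 1) * eta_pair u / cis (pi / 3) ^ 2"
    and eta_ratio_level3': "eta_ratio ((3 * u + 1) / (6 * u + 3)) = 3 / eta_ratio u"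
proof -
  define b where "b = u / (3 * u + 1) - 1"
  have b: "Im b > 0" using Im_level3_pos[OF u] by (simp add: b_def)
  have nz: "3 * u + 1 \<noteq> 0" "2 * u + 1 \<noteq> 0" "b \<noteq> 0" "6 * u + 3 \<noteq> 0" using u b by (auto simp: complex_eq_iff)
  have bu: "b = - (2 * u + 1) / (3 * u + 1)" using nz by (simp add: b_def field_simps)
  have "B / (3 * A) = - 1 / (3 * (- A / B))" if "A \<noteq> 0" "B \<noteq> 0" for A B :: complex
    using that by (simp add: field_simps)
  from this[OF nz(2,1)] have eq: "(3 * u + 1) / (6 * u + 3) = - 1 / (3 * b)"
    unfolding bu by (simp add: algebra_simps)
  have pb: "eta_pair b = (3 * u + 1) * eta_pair u / cis (pi / 3) ^ 2"
    using eta_pair_plus_1[of b] eta_pair_level3[OF u] by (simp add: b_def field_simps power2_eq_square)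
  show "eta_pair ((3 * u + 1) / (6 * u + 3)) = of_real (sqrt 3) * \<i> * (2 * u + 1) * eta_pair u / cis (pi / 3) ^ 2"
  proof -
    have "eta_pair ((3 * u + 1) / (6 * u + 3)) =
        of_real (sqrt 3) * (- \<i> * ((3 * u + 1) * b)) * eta_pair u / cis (pi / 3) ^ 2"
      unfolding eq eta_pair_fricke[OF b] pb by simp
    also have "(3 * u + 1) * b = - (2 * u + 1)" unfolding bu using nz by simp
    finally show ?thesis by (simp add: algebra_simps)
  qed
  have rb: "eta_ratio b = eta_ratio u"
    using eta_ratio_plus_1[of b] eta_ratio_level3[OF u] by (simp add: b_def field_simps)
  show "eta_ratio ((3 * u + 1) / (6 * u + 3)) = 3 / eta_ratio u"
    unfolding eq eta_ratio_fricke[OF b] rb ..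
qed

text \<open>A second map of determinant 21, with its pole at -1/2 instead of 0. As for determinant
  7, z and 7z reduce to one level 3 map, now at u = 7z + 3 and at z; x becomes 7/x and y is
  fixed.\<close>

lemma level21_atkin_lehner_21:
  assumes z: "Im z > 0"
  shows "level21 ((21 * z + 10) / (42 * z + 21)) = level21 z"
proof (rule level21_cong)
  define u where "u = 7 * z + of_nat 3"
  have u: "Im u > 0" using z by (simp add: u_def)
  have nz: "2 * z + 1 \<noteq> 0" "2 * u + 1 \<noteq> 0" "6 * z + 3 \<noteq> 0" using z u by (auto simp: complex_eq_iff)
  have e1: "(21 * z + 10) / (42 * z + 21) = (3 * u + 1) / (6 * u + 3)" by (simp add: u_def algebra_simps)
  have "42 * z + 21 = 7 * (6 * z + 3)" by (simp add: algebra_simps)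
  then have "7 * ((21 * z + 10) / (42 * z + 21)) = (21 * z + 10) / (6 * z + 3)"
    by (simp only: seven_cancel)
  also have "\<dots> = (3 * z + 1) / (6 * z + 3) + of_nat 3" using nz by (simp add: field_simps)
  finally have e2: "7 * ((21 * z + 10) / (42 * z + 21)) = (3 * z + 1) / (6 * z + 3) + of_nat 3" .
  have pu: "eta_pair u = cis (pi / 3) ^ 3 * eta_pair (7 * z)" and ru: "eta_ratio u = eta_ratio (7 * z) / cis (pi / 3) ^ 3"
    unfolding u_def by (rule eta_pair_plus_nat, rule eta_ratio_plus_nat)
  have u7: "2 * u + 1 = 7 * (2 * z + 1)" by (simp add: u_def algebra_simps)
  define c where "c = of_real (sqrt 3) * \<i> * cis (pi / 3)"
  have c: "c \<noteq> 0" by (simp add: c_def)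
  have E1: "eta_pair ((21 * z + 10) / (42 * z + 21)) = 7 * ((2 * z + 1) * c * eta_pair (7 * z))"
    unfolding e1 eta_pair_level3'[OF u] unfolding pu u7 c_def by (simp add: eval_nat_numeral)
  have E2: "eta_pair (7 * ((21 * z + 10) / (42 * z + 21))) = (2 * z + 1) * c * eta_pair z"
    unfolding e2 eta_pair_plus_nat eta_pair_level3'[OF z] c_def by (simp add: eval_nat_numeral)
  show "eta_pair ((21 * z + 10) / (42 * z + 21)) / eta_pair (7 * ((21 * z + 10) / (42 * z + 21))) = eta_pair z / eta_pair (7 * z) \<or>
      eta_pair ((21 * z + 10) / (42 * z + 21)) / eta_pair (7 * ((21 * z + 10) / (42 * z + 21))) = 7 * (eta_pair (7 * z) / eta_pair z)"
    unfolding E1 E2 using nz c by simp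
  show "eta_ratio ((21 * z + 10) / (42 * z + 21)) / eta_ratio (7 * ((21 * z + 10) / (42 * z + 21))) = eta_ratio z / eta_ratio (7 * z) \<or>
      eta_ratio ((21 * z + 10) / (42 * z + 21)) / eta_ratio (7 * ((21 * z + 10) / (42 * z + 21))) = eta_ratio (7 * z) / eta_ratio z"
    unfolding e2 eta_ratio_plus_nat eta_ratio_level3'[OF z] unfolding e1 eta_ratio_level3'[OF u] ru
    by (simp add: cis_pi_3_power_3)
qed

section \<open>Reduction to a strip bounded away from the real axis\<close>

lemma Im_moebius:
  fixes a b c d :: real
  assumes "c * Re z + d \<noteq> 0 \<or> c * Im z \<noteq> 0"
  shows "Im ((of_real a * z + of_real b) / (of_real c * z + of_real d)) =
    (a * d - b * c) * Im z / ((c * Re z + d)\<^sup>2 + (c * Im z)\<^sup>2)"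
  by (simp add: Im_divide algebra_simps)

text \<open>\<open>m\<close> stands for the determinant of a Moebius map and \<open>D\<close> for
  the squared modulus of its denominator, so \<open>m * y / D\<close> is the new imaginary
  part.\<close>

lemma less_divide_of_mult_le:
  fixes y D :: real
  assumes "y > 0" "D > 0" "m > 0" "D \<le> m * (98/100)"
  shows "y \<le> 98/100 * (m * y / D)"
proof -
  have "y * D \<le> y * (m * (98/100))" using assms by (intro mult_left_mono) auto
  then show ?thesis using assms by (simp add: field_simps)
qed

lemma power2_le_of_bounds:
  fixes x c :: real
  assumes "- c \<le> x" "x \<le> c"
  shows "x\<^sup>2 \<le> c\<^sup>2"
  using assms by (intro abs_le_square_iff[THEN iffD1]) (simp add: abs_le_iff)

text \<open>For \<open>Im z \<le> 1/50\<close> the strip \<open>|Re z| \<le> 1/2\<close> is covered by the isometric circles of the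
  involutions, centred at \<open>0\<close>, \<open>\<plusminus>1/3\<close> and \<open>\<plusminus>1/2\<close> with radii \<open>1/\<surd>21\<close>, \<open>\<surd>7/21\<close> and \<open>1/(2\<surd>21)\<close>;
  the bound \<open>98/100\<close> makes the gain in \<open>Im z\<close> uniform.\<close>

lemma level21_step:
  assumes y: "0 < Im z" "Im z \<le> 1/50" and x: "\<bar>Re z\<bar> \<le> 1/2"
  obtains z' where "Im z \<le> 98/100 * Im z'" "level21 z' = level21 z"
proof -
  have y2: "(Im z)\<^sup>2 \<le> 1/2500"
    using power_mono[of "Im z" "1/50" 2] y by (simp add: power2_eq_square)
  have ypos: "(Im z)\<^sup>2 > 0" using y by simp
  have z: "Im z > 0" by fact
  \<comment> \<open>The cut points 3/14 and 3/7 lie in the overlaps of neighbouring circles. The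
    tightest case is (1), with 441 (9/196 + 1/2500) = 20.4264 against 21 * 0.98 = 20.58.\<close>
  consider (1) "\<bar>Re z\<bar> \<le> 3/14" | (2) "-3/7 \<le> Re z" "Re z \<le> -3/14" | (3) "3/14 \<le> Re z" "Re z \<le> 3/7"
    | (4) "Re z \<le> -3/7" | (5) "3/7 \<le> Re z"
    by linarith
  then show ?thesis
  proof cases
    case 1
    have "(Re z)\<^sup>2 \<le> (3/14)\<^sup>2" using 1 by (intro power2_le_of_bounds) auto
    have eq: "- 1 / (21 * z) = (of_real 0 * z + of_real (-1)) / (of_real 21 * z + of_real 0)" by simp
    have "Im (- 1 / (21 * z)) = 21 * Im z / ((21 * Re z)\<^sup>2 + (21 * Im z)\<^sup>2)"
      unfolding eq by (subst Im_moebius) (use y in auto)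
    moreover have "(21 * Re z)\<^sup>2 + (21 * Im z)\<^sup>2 \<le> 21 * (98/100)"
      using \<open>(Re z)\<^sup>2 \<le> (3/14)\<^sup>2\<close> y2 by (simp add: power_mult_distrib power2_eq_square)
    moreover have "(21 * Re z)\<^sup>2 + (21 * Im z)\<^sup>2 > 0" using y by (simp add: add_nonneg_pos)
    ultimately have "Im z \<le> 98/100 * Im (- 1 / (21 * z))"
      using less_divide_of_mult_le[of "Im z" "(21 * Re z)\<^sup>2 + (21 * Im z)\<^sup>2" 21] y by simp
    then show ?thesis using that level21_fricke[OF z] by blast
  next
    case 2
    have "(3 * Re z + 1)\<^sup>2 \<le> (5/14)\<^sup>2" using 2 by (intro power2_le_of_bounds) auto
    have eq: "(7 * z + 2) / (21 * z + 7) = (of_real 7 * z + of_real 2) / (of_real 21 * z + of_real 7)" by simp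
    have "Im ((7 * z + 2) / (21 * z + 7)) = 7 * Im z / ((21 * Re z + 7)\<^sup>2 + (21 * Im z)\<^sup>2)"
      unfolding eq by (subst Im_moebius) (use y in auto)
    moreover have "(21 * Re z + 7)\<^sup>2 + (21 * Im z)\<^sup>2 \<le> 7 * (98/100)"
    proof -
      have "(21 * Re z + 7)\<^sup>2 = 49 * (3 * Re z + 1)\<^sup>2" by (simp add: power2_eq_square algebra_simps)
      then show ?thesis using \<open>(3 * Re z + 1)\<^sup>2 \<le> (5/14)\<^sup>2\<close> y2 by (simp add: power_mult_distrib power_divide)
    qed
    moreover have "(21 * Re z + 7)\<^sup>2 + (21 * Im z)\<^sup>2 > 0" using y by (simp add: add_nonneg_pos)
    ultimately have "Im z \<le> 98/100 * Im ((7 * z + 2) / (21 * z + 7))"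
      using less_divide_of_mult_le[of "Im z" "(21 * Re z + 7)\<^sup>2 + (21 * Im z)\<^sup>2" 7] y by simp
    then show ?thesis using that level21_atkin_lehner_7[OF z] by blast
  next
    case 3
    \<comment> \<open>For the centre +1/3 the map of determinant 7 is used backwards:
      \<open>v\<close> is the preimage of z under it.\<close>
    define v where "v = (7 * z - 2) / (- 21 * z + 7)"
    have "(3 * Re z - 1)\<^sup>2 \<le> (5/14)\<^sup>2" using 3 by (intro power2_le_of_bounds) auto
    have eq: "v = (of_real 7 * z + of_real (-2)) / (of_real (-21) * z + of_real 7)" by (simp add: v_def)
    have Imv: "Im v = 7 * Im z / ((-21 * Re z + 7)\<^sup>2 + (-21 * Im z)\<^sup>2)"
      unfolding eq by (subst Im_moebius) (use y in auto)
    moreover have "(-21 * Re z + 7)\<^sup>2 + (-21 * Im z)\<^sup>2 \<le> 7 * (98/100)"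
    proof -
      have "(-21 * Re z + 7)\<^sup>2 = 49 * (3 * Re z - 1)\<^sup>2" by (simp add: power2_eq_square algebra_simps)
      then show ?thesis using \<open>(3 * Re z - 1)\<^sup>2 \<le> (5/14)\<^sup>2\<close> y2 by (simp add: power_mult_distrib power_divide)
    qed
    moreover have D: "(-21 * Re z + 7)\<^sup>2 + (-21 * Im z)\<^sup>2 > 0" using y by (simp add: add_nonneg_pos)
    ultimately have "Im z \<le> 98/100 * Im v"
      using less_divide_of_mult_le[of "Im z" "(-21 * Re z + 7)\<^sup>2 + (-21 * Im z)\<^sup>2" 7] y by simp
    moreover have "Im v > 0" unfolding Imv using y D by simp
    moreover have "(7 * v + 2) / (21 * v + 7) = z"
    proof -
      have "- 21 * z + 7 \<noteq> 0" using y by (auto simp: complex_eq_iff)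
      then have "7 * v + 2 = 7 * z / (- 21 * z + 7)" "21 * v + 7 = 7 / (- 21 * z + 7)"
        unfolding v_def by (simp_all add: field_simps)
      then show ?thesis using \<open>- 21 * z + 7 \<noteq> 0\<close> by simp
    qed
    ultimately show ?thesis using that level21_atkin_lehner_7[of v] by simp
  next
    case 4
    have "(2 * Re z + 1)\<^sup>2 \<le> (1/7)\<^sup>2" using 4 x by (intro power2_le_of_bounds) auto
    have eq: "(21 * z + 10) / (42 * z + 21) = (of_real 21 * z + of_real 10) / (of_real 42 * z + of_real 21)" by simp
    have "Im ((21 * z + 10) / (42 * z + 21)) = 21 * Im z / ((42 * Re z + 21)\<^sup>2 + (42 * Im z)\<^sup>2)"
      unfolding eq by (subst Im_moebius) (use y in auto)
    moreover have "(42 * Re z + 21)\<^sup>2 + (42 * Im z)\<^sup>2 \<le> 21 * (98/100)"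
    proof -
      have "(42 * Re z + 21)\<^sup>2 = 441 * (2 * Re z + 1)\<^sup>2" by (simp add: power2_eq_square algebra_simps)
      then show ?thesis using \<open>(2 * Re z + 1)\<^sup>2 \<le> (1/7)\<^sup>2\<close> y2 by (simp add: power_mult_distrib power_divide)
    qed
    moreover have "(42 * Re z + 21)\<^sup>2 + (42 * Im z)\<^sup>2 > 0" using y by (simp add: add_nonneg_pos)
    ultimately have "Im z \<le> 98/100 * Im ((21 * z + 10) / (42 * z + 21))"
      using less_divide_of_mult_le[of "Im z" "(42 * Re z + 21)\<^sup>2 + (42 * Im z)\<^sup>2" 21] y by simp
    then show ?thesis using that level21_atkin_lehner_21[OF z] by blast
  next
    case 5
    \<comment> \<open>Translation moves the centre 1/2 to -1/2.\<close>
    define v where "v = z - 1"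
    have v: "Im v = Im z" "Re v = Re z - 1" by (simp_all add: v_def)
    have "(2 * Re v + 1)\<^sup>2 \<le> (1/7)\<^sup>2" using 5 x v by (intro power2_le_of_bounds) auto
    have eq: "(21 * v + 10) / (42 * v + 21) = (of_real 21 * v + of_real 10) / (of_real 42 * v + of_real 21)" by simp
    have "Im ((21 * v + 10) / (42 * v + 21)) = 21 * Im v / ((42 * Re v + 21)\<^sup>2 + (42 * Im v)\<^sup>2)"
      unfolding eq by (subst Im_moebius) (use y v in auto)
    moreover have "(42 * Re v + 21)\<^sup>2 + (42 * Im v)\<^sup>2 \<le> 21 * (98/100)"
    proof -
      have "(42 * Re v + 21)\<^sup>2 = 441 * (2 * Re v + 1)\<^sup>2" by (simp add: power2_eq_square algebra_simps)
      then show ?thesis using \<open>(2 * Re v + 1)\<^sup>2 \<le> (1/7)\<^sup>2\<close> y2 v(1) by (simp add: power_mult_distrib power_divide)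
    qed
    moreover have "(42 * Re v + 21)\<^sup>2 + (42 * Im v)\<^sup>2 > 0" using y v by (simp add: add_nonneg_pos)
    ultimately have "Im v \<le> 98/100 * Im ((21 * v + 10) / (42 * v + 21))"
      using less_divide_of_mult_le[of "Im v" "(42 * Re v + 21)\<^sup>2 + (42 * Im v)\<^sup>2" 21] y v by simp
    moreover have "level21 v = level21 z" using level21_plus_1[of v] by (simp add: v_def)
    ultimately show ?thesis using that level21_atkin_lehner_21[of v] y v by simp
  qed
qed

lemma level21_reduce:
  assumes "Im z > 0"
  obtains z' where "\<bar>Re z'\<bar> \<le> 1/2" "1/50 \<le> Im z'" "level21 z' = level21 z"
proof -
  \<comment> \<open>Below height 1/50 each step raises Im z at least by the factor 100/98, so
    \<open>n\<close> bounds the number of steps that remain.\<close>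
  have "\<exists>z'. \<bar>Re z'\<bar> \<le> 1/2 \<and> 1/50 \<le> Im z' \<and> level21 z' = level21 z"
    if "0 < Im z" "1/50 * (98/100) ^ n \<le> Im z" for n z
    using that
  proof (induction n arbitrary: z)
    case 0
    define z1 where "z1 = z + of_int (- round (Re z))"
    have "\<bar>Re z1\<bar> \<le> 1/2" using of_int_round_abs_le[of "Re z"] unfolding z1_def abs_le_iff by auto
    moreover have "Im z1 = Im z" "level21 z1 = level21 z"
      unfolding z1_def by (simp, rule level21_plus_int)
    ultimately show ?case using 0 by auto
  next
    case (Suc n)
    define z1 where "z1 = z + of_int (- round (Re z))"
    have x: "\<bar>Re z1\<bar> \<le> 1/2" using of_int_round_abs_le[of "Re z"] unfolding z1_def abs_le_iff by auto
    have z1: "Im z1 = Im z" "level21 z1 = level21 z"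
      unfolding z1_def by (simp, rule level21_plus_int)
    show ?case
    proof (cases "1/50 \<le> Im z")
      case True
      then show ?thesis using x z1 by auto
    next
      case False
      then obtain z2 where z2: "Im z1 \<le> 98/100 * Im z2" "level21 z2 = level21 z1"
        using level21_step[of z1] x z1(1) Suc.prems(1) by (metis less_eq_real_def not_le)
      have "1/50 * (98/100) ^ n \<le> Im z2" "0 < Im z2" using z2 z1 Suc.prems by simp_all
      then show ?thesis using Suc.IH[of z2] z2 z1 by metis
    qed
  qed
  moreover obtain n where "(98/100 :: real) ^ n < 50 * Im z"
    using real_arch_pow_inv[of "50 * Im z" "98/100"] assms by auto
  then have "1/50 * (98/100) ^ n \<le> Im z" by simp
  ultimately show ?thesis using assms that by blast
qed

section \<open>Behaviour at the cusp\<close>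

definition pair_quot :: "complex \<Rightarrow> complex" where
  "pair_quot q = phi_prod q * phi_prod (q ^ 3) / (phi_prod (q ^ 7) * phi_prod (q ^ 21))"

definition ratio_quot :: "complex \<Rightarrow> complex" where
  "ratio_quot q = (phi_prod q * phi_prod (q ^ 21) / (phi_prod (q ^ 3) * phi_prod (q ^ 7))) ^ 2"

text \<open>The modular equation in q = exp(2 pi i z). The eta prefactors contribute 1/q to x and q
  to y; what remains, \<open>pair_quot\<close> and \<open>ratio_quot\<close>, is regular at 0 with
  value 1.\<close>

definition level21q :: "complex \<Rightarrow> complex" where
  "level21q q = pair_quot q / q + 7 * q / pair_quot q - q * ratio_quot q - 1 / (q * ratio_quot q) + 3"

lemma norm_power_less_1: "norm (q::complex) < 1 \<Longrightarrow> n > 0 \<Longrightarrow> norm (q ^ n) < 1"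
  by (simp add: norm_power power_less_one_iff)

lemma phi_prod_power_nonzero: "norm q < 1 \<Longrightarrow> n > 0 \<Longrightarrow> phi_prod (q ^ n) \<noteq> 0"
  by (simp add: phi_prod_nonzero norm_power_less_1)

lemma eta_of_nat_mult:
  "eta (of_nat n * z) = exp (of_real pi * \<i> * z / 12) ^ n * phi_prod (exp (2 * of_real pi * \<i> * z) ^ n)"
  by (simp add: eta_def exp_of_nat_mult[symmetric] mult_ac)

lemma level21_eq_level21q:
  assumes "Im z > 0"
  shows "level21 z = level21q (exp (2 * of_real pi * \<i> * z))"
proof -
  define e where "e = exp (of_real pi * \<i> * z / 12)"
  define q where "q = exp (2 * of_real pi * \<i> * z)"
  have e0: "e \<noteq> 0" by (simp add: e_def)
  \<comment> \<open>In terms of e all fractional powers of q become natural powers of one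
    number.\<close>
  have qe: "q = e ^ 24" unfolding q_def e_def by (simp add: exp_of_nat_mult[symmetric] mult_ac)
  have q: "norm q < 1" using assms by (simp add: q_def norm_exp_2pi_i_less_1)
  have eta: "eta (of_nat n * z) = e ^ n * phi_prod (q ^ n)" for n
    unfolding e_def q_def by (rule eta_of_nat_mult)
  have nz: "phi_prod (q ^ n) \<noteq> 0" if "n > 0" for n using phi_prod_power_nonzero[OF q that] .
  have nz1: "phi_prod q \<noteq> 0" using nz[of 1] by simp
  define a1 a3 a7 a21 where "a1 = phi_prod q" and "a3 = phi_prod (q ^ 3)" and "a7 = phi_prod (q ^ 7)"
    and "a21 = phi_prod (q ^ 21)"
  note a_defs = this
  have a: "a1 \<noteq> 0" "a3 \<noteq> 0" "a7 \<noteq> 0" "a21 \<noteq> 0"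
    unfolding a_defs using nz nz1 by simp_all
  have eta': "eta z = e * a1" "eta (3 * z) = e ^ 3 * a3" "eta (7 * z) = e ^ 7 * a7" "eta (21 * z) = e ^ 21 * a21"
    using eta[of 1] eta[of 3] eta[of 7] eta[of 21] by (simp_all add: a_defs)
  have e21: "3 * (7 * z) = 21 * z" by simp
  have 1: "eta_pair z / eta_pair (7 * z) = pair_quot q / q"
    unfolding eta_pair_def e21 eta' pair_quot_def a_defs[symmetric] unfolding qe
    using e0 a by (simp add: field_simps eval_nat_numeral)
  have 2: "eta_ratio z / eta_ratio (7 * z) = q * ratio_quot q"
    unfolding eta_ratio_def e21 eta' ratio_quot_def a_defs[symmetric] unfolding qe
    using e0 a by (simp add: field_simps eval_nat_numeral)
  have "level21 z = eta_pair z / eta_pair (7 * z) + 7 * (1 / (eta_pair z / eta_pair (7 * z)))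
     - eta_ratio z / eta_ratio (7 * z) - 1 / (eta_ratio z / eta_ratio (7 * z)) + 3"
    by (simp add: level21_def)
  then show ?thesis unfolding 1 2 level21q_def q_def[symmetric] by simp
qed

lemma phi_prod_power_has_deriv_0:
  assumes "n \<ge> 2"
  shows "((\<lambda>q. phi_prod (q ^ n)) has_field_derivative 0) (at 0)"
proof -
  have "(phi_prod has_field_derivative - 1) (at (0 ^ n))"
    using phi_prod_deriv_0 assms by (simp add: power_0_left)
  moreover have "((\<lambda>q::complex. q ^ n) has_field_derivative of_nat n * 0 ^ (n - 1)) (at 0)"
    by (auto intro!: derivative_eq_intros)
  ultimately have "((\<lambda>q. phi_prod (q ^ n)) has_field_derivative - 1 * (of_nat n * 0 ^ (n - 1))) (at 0)"
    by (rule DERIV_chain2)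
  then show ?thesis using assms by (simp add: power_0_left)
qed

text \<open>Near 0, \<open>pair_quot\<close> is 1 - q + ... and \<open>1 / ratio_quot\<close> is 1 +
  2q + ..., so the poles cancel and leave -3, which the constant 3 compensates.\<close>

lemma level21q_tendsto_0: "(level21q \<longlongrightarrow> 0) (at 0)"
proof -
  note d = phi_prod_deriv_0 phi_prod_power_has_deriv_0[of 3] phi_prod_power_has_deriv_0[of 7]
    phi_prod_power_has_deriv_0[of 21]
  have dp: "(pair_quot has_field_derivative - 1) (at 0)"
    unfolding pair_quot_def [abs_def]
    by (rule derivative_eq_intros d refl | simp add: power_0_left)+
  have dr: "(ratio_quot has_field_derivative - 2) (at 0)"
    unfolding ratio_quot_def [abs_def]
    by (rule derivative_eq_intros d refl | simp add: power_0_left)+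
  have p0: "pair_quot 0 = 1" and r0: "ratio_quot 0 = 1"
    by (simp_all add: pair_quot_def ratio_quot_def power_0_left)
  \<comment> \<open>q times the polar and constant part: N and its derivative vanish at 0, hence
    N(q)/q tends to 0.\<close>
  define N where "N q = pair_quot q - 1 / ratio_quot q + 3 * q" for q
  have "(N has_field_derivative 0) (at 0)"
    unfolding N_def [abs_def]
    by (rule derivative_eq_intros dp dr refl | simp add: p0 r0)+
  then have "((\<lambda>q. N q / q) \<longlongrightarrow> 0) (at 0)"
    by (simp add: has_field_derivative_iff N_def p0 r0)
  moreover have "((\<lambda>q. 7 * q / pair_quot q - q * ratio_quot q) \<longlongrightarrow> 7 * 0 / pair_quot 0 - 0 * ratio_quot 0) (at 0)"
    using DERIV_isCont[OF dp] DERIV_isCont[OF dr]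
    by (intro tendsto_intros) (auto simp: isCont_def p0)
  ultimately have "((\<lambda>q. N q / q + (7 * q / pair_quot q - q * ratio_quot q)) \<longlongrightarrow> 0) (at 0)"
    using tendsto_add by fastforce
  moreover have "\<forall>\<^sub>F q in at 0. N q / q + (7 * q / pair_quot q - q * ratio_quot q) = level21q q"
    unfolding eventually_at_filter
    by (intro always_eventually) (auto simp: N_def level21q_def add_divide_distrib diff_divide_distrib)
  ultimately show ?thesis by (rule Lim_transform_eventually)
qed

lemma level21_small_near_cusp:
  assumes "\<epsilon> > 0"
  obtains Y where "\<And>z. Im z > Y \<Longrightarrow> Im z > 0 \<Longrightarrow> norm (level21 z) < \<epsilon>"
proof -
  obtain d where d: "d > 0" "\<And>q. q \<noteq> 0 \<Longrightarrow> norm q < d \<Longrightarrow> norm (level21q q) < \<epsilon>"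
    using level21q_tendsto_0 assms unfolding Lim_at by (auto simp: dist_norm)
  have "norm (level21 z) < \<epsilon>" if z: "Im z > - ln d / (2 * pi)" "Im z > 0" for z
  proof -
    have "- (2 * pi * Im z) < ln d" using z(1) by (simp add: field_simps)
    then have "exp (- (2 * pi * Im z)) < d" using d(1) by (metis exp_less_mono exp_ln)
    then show ?thesis
      unfolding level21_eq_level21q[OF z(2)] by (intro d(2)) (simp_all add: norm_exp_2pi_i)
  qed
  then show ?thesis using that by blast
qed

section \<open>Vanishing by the maximum modulus principle\<close>

lemma eta_mult_holomorphic:
  fixes c :: real
  assumes "c > 0"
  shows "(\<lambda>z. eta (of_real c * z)) holomorphic_on {z. Im z > 0}"
proof -
  have "eta \<circ> (\<lambda>z. of_real c * z) holomorphic_on {z. Im z > 0}"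
    using assms by (intro holomorphic_on_compose_gen[OF _ eta_holomorphic] holomorphic_intros) auto
  then show ?thesis by (simp add: o_def)
qed

lemma level21_holomorphic: "level21 holomorphic_on {z. Im z > 0}"
proof -
  have h: "(\<lambda>z. eta (3 * z)) holomorphic_on {z. Im z > 0}" "(\<lambda>z. eta (7 * z)) holomorphic_on {z. Im z > 0}"
    "(\<lambda>z. eta (3 * (7 * z))) holomorphic_on {z. Im z > 0}"
    using eta_mult_holomorphic[of 3] eta_mult_holomorphic[of 7] eta_mult_holomorphic[of 21] by simp_all
  show ?thesis
    unfolding level21_def [abs_def] eta_pair_def eta_ratio_def
    by (intro holomorphic_intros eta_holomorphic h) (auto simp: eta_nonzero)
qed

lemma level21_eq_0:
  assumes z0: "Im z0 > 0"
  shows "level21 z0 = 0"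
proof (rule ccontr)
  assume nz: "level21 z0 \<noteq> 0"
  define H where "H = {z. Im z > 0}"
  have H: "open H" "connected H"
    unfolding H_def by (auto intro: open_halfspace_Im_gt convex_connected convex_halfspace_Im_gt)
  \<comment> \<open>The height is chosen relative to \<open>z0\<close>, so that points above it
    cannot compete with the maximum over the compact box \<open>K\<close>.\<close>
  obtain Y where Y: "\<And>z. Im z > Y \<Longrightarrow> Im z > 0 \<Longrightarrow> norm (level21 z) < norm (level21 z0)"
    using level21_small_near_cusp[of "norm (level21 z0)"] nz by auto
  define K where "K = cbox (Complex (-1/2) (1/50)) (Complex (1/2) Y)"
  have inK: "z \<in> K \<longleftrightarrow> \<bar>Re z\<bar> \<le> 1/2 \<and> 1/50 \<le> Im z \<and> Im z \<le> Y" for z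
    unfolding K_def in_cbox_complex_iff by auto
  have KH: "K \<subseteq> H" by (auto simp: inK H_def)
  \<comment> \<open>The reduced point cannot lie above height Y, where the norm would be smaller
    than the value it shares with \<open>z0\<close>.\<close>
  obtain z1 where z1: "z1 \<in> K" "level21 z1 = level21 z0"
    using level21_reduce[OF z0] Y inK by (metis less_irrefl not_le order_less_le_trans zero_less_divide_1_iff zero_less_numeral)
  have "continuous_on K (\<lambda>z. norm (level21 z))"
    using level21_holomorphic KH unfolding H_def
    by (intro continuous_on_norm holomorphic_on_imp_continuous_on) (rule holomorphic_on_subset)
  moreover have "compact K" unfolding K_def by (rule compact_cbox)
  ultimately obtain m where m: "m \<in> K" "\<And>z. z \<in> K \<Longrightarrow> norm (level21 z) \<le> norm (level21 m)"
    using continuous_attains_sup[of K "\<lambda>z. norm (level21 z)"] z1(1) by blast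
  have m0: "norm (level21 z0) \<le> norm (level21 m)" using m(2)[OF z1(1)] z1(2) by simp
  have "norm (level21 z) \<le> norm (level21 m)" if z: "z \<in> H" for z
  proof -
    have "Im z > 0" using z by (simp add: H_def)
    then obtain z' where z': "\<bar>Re z'\<bar> \<le> 1/2" "1/50 \<le> Im z'" "level21 z' = level21 z"
      by (rule level21_reduce)
    show ?thesis
    proof (cases "Im z' \<le> Y")
      case True
      then show ?thesis using m(2)[of z'] z' by (simp add: inK)
    next
      case False
      then show ?thesis using Y[of z'] z' m0 by simp
    qed
  qed
  moreover have "m \<in> H" using m(1) KH by blast
  ultimately have "level21 constant_on H"
    using level21_holomorphic H unfolding H_def[symmetric]
    by (intro maximum_modulus_principle[of level21 H H m]) auto
  then obtain c where c: "\<And>z. z \<in> H \<Longrightarrow> level21 z = c" unfolding constant_on_def by blast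
  \<comment> \<open>A point above height Y: its value equals that at \<open>z0\<close> by constancy,
    yet has smaller norm.\<close>
  define z2 where "z2 = Complex 0 (max Y 1 + 1)"
  have "z2 \<in> H" "Im z2 > Y" "z0 \<in> H" using z0 by (auto simp: z2_def H_def)
  then show False using Y[of z2] c[of z2] c[of z0] by (simp add: H_def)
qed

lemma level21q_eq_0:
  assumes "q \<noteq> 0" "norm q < 1"
  shows "level21q q = 0"
proof -
  define z where "z = Ln q / (2 * of_real pi * \<i>)"
  have q: "exp (2 * of_real pi * \<i> * z) = q" using assms by (simp add: z_def)
  have "exp (- (2 * pi * Im z)) < 1" using norm_exp_2pi_i[of z] q assms by simp
  then have "Im z > 0" by (simp add: zero_less_mult_iff)
  then show ?thesis using level21_eq_0 level21_eq_level21q q by metis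
qed

section \<open>Elimination\<close>

definition target :: "complex \<Rightarrow> complex \<Rightarrow> complex" where
  "target P Q = P ^ 2 + 1 / P ^ 2 -
    (Q ^ 2 + 1 / Q ^ 2 + (P + 1 / P) * (3 + (Q + 1 / Q) ^ 2 + 3 * (Q + 1 / Q)) + 1)"

text \<open>Both equations become quadratics in Y with a common root. Two linear combinations are
  linear in Y after cancelling Y, and eliminating Y between them leaves a relation in P and Q that
  contains the factor (P - 1)^2.\<close>

lemma elimination:
  assumes nz: "P \<noteq> 0" "Q \<noteq> 0" "Y \<noteq> 0"
    and 1: "P * Y + 7 / (P * Y) = P * Q + 1 / (P * Q) - 3"
    and 2: "Y + 7 / Y = P / Q + Q / P - 3"
  shows "(P - 1) ^ 2 * target P Q = 0"
proof -
  define a b where "a = P ^ 2 * Q ^ 2 + 1 - 3 * P * Q" and "b = P ^ 2 + Q ^ 2 - 3 * P * Q"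
  have "P * (Q * (P ^ 2 * Y ^ 2 + 7)) = P * (a * Y)"
    using 1 nz by (simp add: a_def field_simps power2_eq_square)
  then have 3: "Q * (P ^ 2 * Y ^ 2 + 7) = a * Y" using nz by simp
  have 4: "P * Q * (Y ^ 2 + 7) = b * Y"
    using 2 nz by (simp add: b_def field_simps power2_eq_square)
  \<comment> \<open>Up to factors cancelled later, P times \<open>4\<close> minus \<open>3\<close>
    removes the Y^2 term, and P times \<open>3\<close> minus \<open>4\<close> removes the constant
    term.\<close>
  have 5: "Y * (7 * P * Q * (P ^ 2 - 1)) = Y * (Y * (P * (b * P - a)))"
    using 3 4 by algebra
  have 6: "Y * (Y * (P * Q * (P ^ 2 - 1))) = Y * (a * P - b)"
    using 3 4 by algebra
  have 8: "7 * Q * (P ^ 2 - 1) = Y * (b * P - a)" using 5 nz by (simp add: mult_ac)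
  have 9: "Y * (P * Q * (P ^ 2 - 1)) = a * P - b" using 6 nz by (simp add: mult_ac)
  \<comment> \<open>Multiply \<open>8\<close> by P Q (P^2 - 1) and replace the product with Y by
    means of \<open>9\<close>.\<close>
  have 7: "7 * P * Q ^ 2 * (P ^ 2 - 1) ^ 2 = (a * P - b) * (b * P - a)"
    using 8 9 by algebra
  define T where "T = P ^ 4 * Q ^ 2 + Q ^ 2 - P ^ 2 * Q ^ 4 - P ^ 2 -
    P * (P ^ 2 + 1) * (3 * Q ^ 2 + (Q ^ 2 + 1) ^ 2 + 3 * Q * (Q ^ 2 + 1)) - P ^ 2 * Q ^ 2"
  have T: "T = P ^ 2 * Q ^ 2 * target P Q"
    unfolding T_def target_def using nz by (simp add: field_simps eval_nat_numeral)
  have "(P - 1) ^ 2 * T = (a * P - b) * (b * P - a) - 7 * P * Q ^ 2 * (P ^ 2 - 1) ^ 2"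
    unfolding T_def a_def b_def by algebra
  then have "(P - 1) ^ 2 * T = 0" using 7 by simp
  then show ?thesis unfolding T using nz by auto
qed

section \<open>P and Q as functions of q, and removal of the factor (P - 1)^2\<close>

definition P_fun :: "complex \<Rightarrow> complex" where
  "P_fun q = q ^ 2 * (phi_prod q * phi_prod (q ^ 63)) / (phi_prod (q ^ 7) * phi_prod (q ^ 9))"

definition Q_fun :: "complex \<Rightarrow> complex" where
  "Q_fun q = phi_prod q * phi_prod (q ^ 21) ^ 2 * phi_prod (q ^ 9) /
     (q * phi_prod (q ^ 3) ^ 2 * phi_prod (q ^ 7) * phi_prod (q ^ 63))"

text \<open>The square root enters P as s^4 = q^2 and Q as s^(-2) = 1/q, which explains the powers
  of q in \<open>P_fun\<close> and \<open>Q_fun\<close>. The level 21 equation is used at q and at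
  q^3.\<close>

lemma elimination_q:
  assumes q: "q \<noteq> 0" "norm q < 1"
  shows "(P_fun q - 1) ^ 2 * target (P_fun q) (Q_fun q) = 0"
proof -
  have nz: "phi_prod (q ^ n) \<noteq> 0" if "n > 0" for n using phi_prod_power_nonzero[OF q(2) that] .
  have nz1: "phi_prod q \<noteq> 0" using nz[of 1] by simp
  define Y where "Y = pair_quot (q ^ 3) / q ^ 3"
  have L1: "pair_quot q / q + 7 / (pair_quot q / q) = q * ratio_quot q + 1 / (q * ratio_quot q) - 3"
    using level21q_eq_0[OF q] by (simp add: level21q_def algebra_simps)
  have L3: "Y + 7 / Y = q ^ 3 * ratio_quot (q ^ 3) + 1 / (q ^ 3 * ratio_quot (q ^ 3)) - 3"
    using level21q_eq_0[of "q ^ 3"] q norm_power_less_1[of q 3] by (simp add: level21q_def Y_def algebra_simps)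
  define a1 a3 a7 a9 a21 a63 where "a1 = phi_prod q" and "a3 = phi_prod (q ^ 3)" and "a7 = phi_prod (q ^ 7)"
    and "a9 = phi_prod (q ^ 9)" and "a21 = phi_prod (q ^ 21)" and "a63 = phi_prod (q ^ 63)"
  note a_defs = this
  have a: "a1 \<noteq> 0" "a3 \<noteq> 0" "a7 \<noteq> 0" "a9 \<noteq> 0" "a21 \<noteq> 0" "a63 \<noteq> 0"
    unfolding a_defs using nz nz1 by simp_all
  have f: "pair_quot q = a1 * a3 / (a7 * a21)" "ratio_quot q = (a1 * a21 / (a3 * a7)) ^ 2"
    "Y = a3 * a9 / (a21 * a63) / q ^ 3" "ratio_quot (q ^ 3) = (a3 * a63 / (a9 * a21)) ^ 2"
    "P_fun q = q ^ 2 * (a1 * a63) / (a7 * a9)" "Q_fun q = a1 * a21 ^ 2 * a9 / (q * a3 ^ 2 * a7 * a63)"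
    unfolding a_defs Y_def pair_quot_def ratio_quot_def P_fun_def Q_fun_def
    by (simp_all flip: power_mult)
  \<comment> \<open>The three relations X = P Y, w_1^2 = P Q and w_3^2 = P/Q in terms of Euler
    products.\<close>
  have e1: "P_fun q * Y = pair_quot q / q"
    unfolding f using q(1) a by (simp add: field_simps eval_nat_numeral)
  have e2: "P_fun q * Q_fun q = q * ratio_quot q"
    unfolding f using q(1) a by (simp add: field_simps eval_nat_numeral)
  have e3: "P_fun q / Q_fun q = q ^ 3 * ratio_quot (q ^ 3)"
    unfolding f using q(1) a by (simp add: field_simps eval_nat_numeral)
  have nzPQY: "P_fun q \<noteq> 0" "Q_fun q \<noteq> 0" "Y \<noteq> 0"
    unfolding f using q(1) a by simp_all
  have "Q_fun q / P_fun q = 1 / (P_fun q / Q_fun q)" by simp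
  then show ?thesis
    by (intro elimination[OF nzPQY]) (simp_all only: e1 e2 e3 L1 L3)
qed

lemma phi_prod_power_holomorphic:
  assumes "n > 0"
  shows "(\<lambda>q. phi_prod (q ^ n)) holomorphic_on ball 0 1"
proof -
  have "phi_prod \<circ> (\<lambda>q. q ^ n) holomorphic_on ball 0 1"
    using assms by (intro holomorphic_on_compose_gen[OF _ phi_prod_holomorphic] holomorphic_intros)
      (auto simp: norm_power_less_1)
  then show ?thesis by (simp add: o_def)
qed

lemma target_eq_0:
  assumes q: "q \<noteq> 0" "norm q < 1"
  shows "target (P_fun q) (Q_fun q) = 0"
proof (cases "P_fun q = 1")
  case False
  then show ?thesis using elimination_q[OF q] by simp
next
  case True
  have nz: "phi_prod (z ^ n) \<noteq> 0" if "n > 0" "z \<in> ball 0 1" for n z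
    using phi_prod_power_nonzero[of z n] that by simp
  have nz1: "phi_prod z \<noteq> 0" if "z \<in> ball 0 1" for z using nz[of 1 z] that by simp
  have P: "P_fun holomorphic_on ball 0 1"
    unfolding P_fun_def [abs_def]
    by (intro holomorphic_intros phi_prod_holomorphic phi_prod_power_holomorphic) (auto simp: nz)
  have Q: "Q_fun holomorphic_on ball 0 1 - {0}"
    unfolding Q_fun_def [abs_def]
    by (intro holomorphic_intros holomorphic_on_subset[OF phi_prod_holomorphic]
        holomorphic_on_subset[OF phi_prod_power_holomorphic]) (auto simp: nz)
  \<comment> \<open>Since P vanishes at 0, the function P - 1 is not identically zero, so its zero
    at q is isolated.\<close>
  have "(\<lambda>z. P_fun z - 1) holomorphic_on ball 0 1" by (intro holomorphic_intros P)
  then have "\<forall>\<^sub>F z in at q. P_fun z - 1 \<noteq> 0 \<and> z \<in> ball 0 1"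
    by (rule non_zero_neighbour_alt[where \<beta> = 0]) (use q in \<open>auto simp: P_fun_def\<close>)
  moreover have "\<forall>\<^sub>F z in at q. z \<noteq> 0"
    using q(1) by (intro eventually_at_in_open'[of "- {0}", THEN eventually_mono]) auto
  ultimately have "\<forall>\<^sub>F z in at q. 0 = target (P_fun z) (Q_fun z)"
  proof eventually_elim
    case (elim z)
    then show ?case using elimination_q[of z] by simp
  qed
  then have "((\<lambda>z. target (P_fun z) (Q_fun z)) \<longlongrightarrow> 0) (at q)"
    by (rule Lim_transform_eventually[OF tendsto_const])
  moreover have "isCont (\<lambda>z. target (P_fun z) (Q_fun z)) q"
  proof -
    have "continuous_on (ball 0 1 - {0}) (\<lambda>z. target (P_fun z) (Q_fun z))"
      unfolding target_def
      using holomorphic_on_imp_continuous_on[OF Q]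
        holomorphic_on_imp_continuous_on[OF holomorphic_on_subset[OF P, of "ball 0 1 - {0}"]]
      by (intro continuous_intros) (auto simp: P_fun_def Q_fun_def nz nz1)
    then show ?thesis using q by (simp add: continuous_on_eq_continuous_at open_Diff)
  qed
  ultimately show ?thesis unfolding isCont_def using tendsto_unique[OF at_neq_bot] by blast
qed

section \<open>The identity for the quotients w_1 and w_3\<close>

theorem theorem3p6:
  fixes q s P Q :: complex
  assumes q: "0 < norm q" "norm q < 1"
    and s: "s ^ 2 = q"
    and s_pos: "\<And>t :: real. 0 < t \<Longrightarrow> q = of_real t \<Longrightarrow> s = of_real (sqrt t)"
    and P: "P = w q s 1 * w q s 3"
    and Q: "Q = w q s 1 / w q s 3"
  shows "P ^ 2 + 1 / P ^ 2 =
    Q ^ 2 + 1 / Q ^ 2 + (P + 1 / P) * (3 + (Q + 1 / Q) ^ 2 + 3 * (Q + 1 / Q)) + 1"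
proof -
  have q0: "q \<noteq> 0" "s \<noteq> 0" using q s by auto
  have nz: "phi_prod (q ^ n) \<noteq> 0" if "n > 0" for n using phi_prod_power_nonzero[OF q(2) that] .
  have nz1: "phi_prod q \<noteq> 0" using nz[of 1] by simp
  have w1: "w q s 1 = s * (phi_prod q * phi_prod (q ^ 21)) / (phi_prod (q ^ 3) * phi_prod (q ^ 7))"
    using q by (simp add: w_def f_sub_eq_phi_prod)
  have w3: "w q s 3 = s ^ 3 * (phi_prod (q ^ 3) * phi_prod (q ^ 63)) / (phi_prod (q ^ 9) * phi_prod (q ^ 21))"
    using q by (simp add: w_def f_sub_eq_phi_prod)
  define a1 a3 a7 a9 a21 a63 where "a1 = phi_prod q" and "a3 = phi_prod (q ^ 3)" and "a7 = phi_prod (q ^ 7)"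
    and "a9 = phi_prod (q ^ 9)" and "a21 = phi_prod (q ^ 21)" and "a63 = phi_prod (q ^ 63)"
  note a_defs = this
  have a: "a1 \<noteq> 0" "a3 \<noteq> 0" "a7 \<noteq> 0" "a9 \<noteq> 0" "a21 \<noteq> 0" "a63 \<noteq> 0"
    unfolding a_defs using nz nz1 by simp_all
  \<comment> \<open>The Euler products are folded into names first, so that rewriting q as s^2 only
    reaches the monomial prefactors.\<close>
  have "P = P_fun q"
    unfolding P w1 w3 P_fun_def a_defs[symmetric] unfolding s[symmetric]
    using a by (simp add: field_simps eval_nat_numeral)
  moreover have "Q = Q_fun q"
    unfolding Q w1 w3 Q_fun_def a_defs[symmetric] unfolding s[symmetric]
    using a q0 by (simp add: field_simps eval_nat_numeral)
  ultimately show ?thesis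
    using target_eq_0[OF q0(1) q(2)] by (simp add: target_def)
qed

end
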